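(* Let $\alpha,\beta>-1$, $0<k<\beta+1$, $\ell\in\mathbb N$, and let $D$ and $E$ be the differential operators given in the context. The algebra of differential operators generated by $D$ and $E$ is isomorphic to the quotient algebra $\mathbb C[x,y]/\langle Q\rangle$, where $\langle Q\rangle$ is the ideal generated by the polynomial $$Q(x,y)=\prod_{j=0}^\ell\big(y-(\alpha-\ell+3j)x+3j(\ell-j+k)(j+\alpha+\beta-k+1)\big).$$
   Context: Matrices are $(\ell+1)\times(\ell+1)$ with rows and columns indexed by $0,\dots,\ell$; $E_{ij}$ is the matrix with $(i,j)$ entry $1$ and all other entries $0$; terms with an index outside $\{0,\dots,\ell\}$ (whose coefficients vanish) are zero. $\mathbb N=\{1,2,\dots\}$. Differential operators have matrix valued polynomial coefficients in $u$ multiplying on the left; the algebra generated by $D$ and $E$ is the unital complex subalgebra, under composition, of the algebra of such operators. $\mathbb C[x,y]$ is the polynomial algebra in two variables. $$D=u(1-u)\frac{d^2}{du^2}+(C-uU)\frac{d}{du}-V,$$ $$E=(1-u)(Q_0+uQ_1)\frac{d^2}{du^2}+(P_0+uP_1)\frac{d}{du}-(\alpha+2\ell+3k)V,$$ where $$C=\sum_{i=0}^\ell(\beta+1+2i)E_{ii}+\sum_{i=1}^\ell iE_{i,i-1},\qquad U=\sum_{i=0}^\ell(\alpha+\beta+\ell+i+2)E_{ii},$$ $$V=\sum_{i=0}^\ell i(\alpha+\beta-k+1+i)E_{ii}-\sum_{i=0}^{\ell-1}(\ell-i)(\beta-k+1+i)E_{i,i+1},$$ $$Q_0=\sum_{i=0}^\ell3iE_{i,i-1},\qquad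 Q_1=\sum_{i=0}^\ell(\alpha-\ell+3i)E_{ii},$$ $$P_0=\sum_{i=0}^\ell\big((\alpha+2\ell)(\beta+1+2i)-3k(\ell-i)-3i(\beta-k+i)\big)E_{ii}-\sum_{i=0}^\ell i(3i+3\beta-3k+3+\ell+2\alpha)E_{i,i-1},$$ $$P_1=-\sum_{i=0}^\ell(\alpha-\ell+3i)(\alpha+\beta+\ell+i+2)E_{ii}+\sum_{i=0}^\ell3(\beta-k+1+i)(\ell-i)E_{i,i+1}.$$ *)

theory Defs
  imports
    Jordan_Normal_Form.Matrix
    "HOL-Algebra.QuotRing"
    "HOL-Algebra.Generated_Rings"
    "HOL-Computational_Algebra.Polynomial"
begin

section \<open>Matrix valued differential operators with polynomial coefficients\<close>

text \<open>
  The list \<open>[A\<^sub>0, \<dots>, A\<^sub>m]\<close> of \<open>n \<times> n\<close> matrices over \<open>\<complex>[u]\<close> stands for the operator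
  \<open>f \<mapsto> \<Sum>j\<le>m. A\<^sub>j(u) f\<^sup>(\<^sup>j\<^sup>)(u)\<close>, realised as a map on the \<open>\<complex>\<^sup>n\<close>-valued polynomials in \<open>u\<close>.
  In characteristic 0 an operator is determined by its values on polynomials,
  so this identifies exactly the operators with the same coefficients.
\<close>

definition diff_op ::
  "nat \<Rightarrow> complex poly mat list \<Rightarrow> complex poly vec \<Rightarrow> complex poly vec" where
  "diff_op n As = (\<lambda>f\<in>carrier_vec n.
     vec n (\<lambda>i. \<Sum>j<length As. (As ! j *\<^sub>v map_vec (pderiv ^^ j) f) $ i))"

definition diff_op_ring :: "nat \<Rightarrow> (complex poly vec \<Rightarrow> complex poly vec) ring" where
  "diff_op_ring n =
     \<lparr> carrier = {diff_op n As | As. set As \<subseteq> carrier_mat n n},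
       mult = compose (carrier_vec n),
       one = (\<lambda>f\<in>carrier_vec n. f),
       zero = (\<lambda>f\<in>carrier_vec n. 0\<^sub>v n),
       add = (\<lambda>F G. \<lambda>f\<in>carrier_vec n. F f + G f) \<rparr>"

definition scalar_op :: "nat \<Rightarrow> complex \<Rightarrow> complex poly vec \<Rightarrow> complex poly vec" where
  "scalar_op n c = (\<lambda>f\<in>carrier_vec n. [:c:] \<cdot>\<^sub>v f)"

text \<open>
  Adding all scalars to the generators turns the generated subring
  into the generated unital complex subalgebra.
\<close>

definition generated_algebra ::
  "nat \<Rightarrow> (complex poly vec \<Rightarrow> complex poly vec) set
     \<Rightarrow> (complex poly vec \<Rightarrow> complex poly vec) ring" where
  "generated_algebra n S =
     (diff_op_ring n)\<lparr>carrier := generate_ring (diff_op_ring n) (range (scalar_op n) \<union> S)\<rparr>"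


section \<open>The polynomial algebra in two variables, and algebra isomorphism\<close>

text \<open>
  \<open>\<complex>[x,y]\<close> is the iterated polynomial ring \<open>\<complex>[x][y]\<close>:
  the inner variable is \<open>x\<close> and the outer one is \<open>y\<close>.
\<close>

definition poly_xy_ring :: "complex poly poly ring" where
  "poly_xy_ring = \<lparr> carrier = UNIV, mult = (*), one = 1, zero = 0, add = (+) \<rparr>"

definition const_xy :: "complex \<Rightarrow> complex poly poly" where
  "const_xy c = [:[:c:]:]"

definition var_x :: "complex poly poly" where
  "var_x = [:[:0, 1:]:]"

definition var_y :: "complex poly poly" where
  "var_y = [:0, 1:]"

definition quotient_xy :: "complex poly poly \<Rightarrow> complex poly poly set ring" where
  "quotient_xy q = poly_xy_ring Quot (Idl\<^bsub>poly_xy_ring\<^esub> {q})"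

definition quotient_xy_scalar :: "complex poly poly \<Rightarrow> complex \<Rightarrow> complex poly poly set" where
  "quotient_xy_scalar q c = (Idl\<^bsub>poly_xy_ring\<^esub> {q}) +>\<^bsub>poly_xy_ring\<^esub> const_xy c"

text \<open>
  A complex algebra is given as a ring together with its structure map from \<open>\<complex>\<close>, sending \<open>c\<close>
  to \<open>c \<cdot> 1\<close>; a ring isomorphism is complex linear iff it commutes with the structure maps.
\<close>

definition complex_alg_isomorphic ::
  "'a ring \<Rightarrow> (complex \<Rightarrow> 'a) \<Rightarrow> 'b ring \<Rightarrow> (complex \<Rightarrow> 'b) \<Rightarrow> bool" where
  "complex_alg_isomorphic R \<iota> S \<kappa> \<longleftrightarrow> (\<exists>\<phi>\<in>ring_iso R S. \<forall>c. \<phi> (\<iota> c) = \<kappa> c)"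


section \<open>The operators \<open>D\<close> and \<open>E\<close> and the polynomial \<open>Q\<close>\<close>

text \<open>
  The entry function of the matrix unit \<open>E\<^sub>i\<^sub>j\<close>.
  In the sums below every summand with an index outside \<open>{0..l}\<close> has coefficient 0,
  in particular the summand \<open>i = 0\<close> of \<open>E\<^sub>i\<^sub>,\<^sub>i\<^sub>-\<^sub>1\<close>, where \<open>i - 1\<close> is truncated.
\<close>

definition munit :: "nat \<Rightarrow> nat \<Rightarrow> nat \<times> nat \<Rightarrow> real" where
  "munit i j = (\<lambda>rc. of_bool (rc = (i, j)))"

text \<open>Constant real matrices, viewed as matrices over \<open>\<complex>[u]\<close>.\<close>

definition const_mat :: "nat \<Rightarrow> (nat \<times> nat \<Rightarrow> real) \<Rightarrow> complex poly mat" where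
  "const_mat n a = mat n n (\<lambda>rc. [:complex_of_real (a rc):])"

definition matC :: "nat \<Rightarrow> real \<Rightarrow> complex poly mat" where
  "matC l \<beta> = const_mat (l + 1) (\<lambda>rc.
     (\<Sum>i=0..l. (\<beta> + 1 + 2 * real i) * munit i i rc)
     + (\<Sum>i=1..l. real i * munit i (i - 1) rc))"

definition matU :: "nat \<Rightarrow> real \<Rightarrow> real \<Rightarrow> complex poly mat" where
  "matU l \<alpha> \<beta> = const_mat (l + 1) (\<lambda>rc.
     \<Sum>i=0..l. (\<alpha> + \<beta> + real l + real i + 2) * munit i i rc)"

definition matV :: "nat \<Rightarrow> real \<Rightarrow> real \<Rightarrow> real \<Rightarrow> complex poly mat" where
  "matV l \<alpha> \<beta> k = const_mat (l + 1) (\<lambda>rc.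
     (\<Sum>i=0..l. real i * (\<alpha> + \<beta> - k + 1 + real i) * munit i i rc)
     - (\<Sum>i<l. (real l - real i) * (\<beta> - k + 1 + real i) * munit i (i + 1) rc))"

definition matQ0 :: "nat \<Rightarrow> complex poly mat" where
  "matQ0 l = const_mat (l + 1) (\<lambda>rc. \<Sum>i=0..l. 3 * real i * munit i (i - 1) rc)"

definition matQ1 :: "nat \<Rightarrow> real \<Rightarrow> complex poly mat" where
  "matQ1 l \<alpha> = const_mat (l + 1) (\<lambda>rc.
     \<Sum>i=0..l. (\<alpha> - real l + 3 * real i) * munit i i rc)"

definition matP0 :: "nat \<Rightarrow> real \<Rightarrow> real \<Rightarrow> real \<Rightarrow> complex poly mat" where
  "matP0 l \<alpha> \<beta> k = const_mat (l + 1) (\<lambda>rc.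
     (\<Sum>i=0..l. ((\<alpha> + 2 * real l) * (\<beta> + 1 + 2 * real i) - 3 * k * (real l - real i)
                  - 3 * real i * (\<beta> - k + real i)) * munit i i rc)
     - (\<Sum>i=0..l. real i * (3 * real i + 3 * \<beta> - 3 * k + 3 + real l + 2 * \<alpha>)
                  * munit i (i - 1) rc))"

definition matP1 :: "nat \<Rightarrow> real \<Rightarrow> real \<Rightarrow> real \<Rightarrow> complex poly mat" where
  "matP1 l \<alpha> \<beta> k = const_mat (l + 1) (\<lambda>rc.
     - (\<Sum>i=0..l. (\<alpha> - real l + 3 * real i) * (\<alpha> + \<beta> + real l + real i + 2) * munit i i rc)
     + (\<Sum>i=0..l. 3 * (\<beta> - k + 1 + real i) * (real l - real i) * munit i (i + 1) rc))"

abbreviation polU :: "complex poly" where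
  "polU \<equiv> [:0, 1:]"

definition opD :: "nat \<Rightarrow> real \<Rightarrow> real \<Rightarrow> real \<Rightarrow> complex poly vec \<Rightarrow> complex poly vec" where
  "opD l \<alpha> \<beta> k = diff_op (l + 1)
     [ - matV l \<alpha> \<beta> k,
       matC l \<beta> - polU \<cdot>\<^sub>m matU l \<alpha> \<beta>,
       (polU * (1 - polU)) \<cdot>\<^sub>m 1\<^sub>m (l + 1) ]"

definition opE :: "nat \<Rightarrow> real \<Rightarrow> real \<Rightarrow> real \<Rightarrow> complex poly vec \<Rightarrow> complex poly vec" where
  "opE l \<alpha> \<beta> k = diff_op (l + 1)
     [ - ([:complex_of_real (\<alpha> + 2 * real l + 3 * k):] \<cdot>\<^sub>m matV l \<alpha> \<beta> k),
       matP0 l \<alpha> \<beta> k + polU \<cdot>\<^sub>m matP1 l \<alpha> \<beta> k,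
       (1 - polU) \<cdot>\<^sub>m (matQ0 l + polU \<cdot>\<^sub>m matQ1 l \<alpha>) ]"

definition polyQ :: "nat \<Rightarrow> real \<Rightarrow> real \<Rightarrow> real \<Rightarrow> complex poly poly" where
  "polyQ l \<alpha> \<beta> k = (\<Prod>j=0..l.
     var_y - const_xy (of_real (\<alpha> - real l + 3 * real j)) * var_x
     + const_xy (of_real (3 * real j * (real l - real j + k) * (real j + \<alpha> + \<beta> - k + 1))))"


section \<open>The two ambient rings are rings\<close>

lemma cring_poly_xy_ring: "cring poly_xy_ring"
proof (rule cringI)
  show "abelian_group poly_xy_ring"
  proof (rule abelian_groupI)
    fix x :: "complex poly poly"
    show "\<exists>y\<in>carrier poly_xy_ring. y \<oplus>\<^bsub>poly_xy_ring\<^esub> x = \<zero>\<^bsub>poly_xy_ring\<^esub>"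
      by (rule bexI[of _ "- x"]) (auto simp: poly_xy_ring_def)
  qed (auto simp: poly_xy_ring_def algebra_simps)
  show "Group.comm_monoid poly_xy_ring"
    by unfold_locales (auto simp: poly_xy_ring_def algebra_simps)
qed (auto simp: poly_xy_ring_def algebra_simps)

lemma diff_op_closed: "f \<in> carrier_vec n \<Longrightarrow> diff_op n As f \<in> carrier_vec n"
  by (simp add: diff_op_def)

lemma diff_op_Nil: "diff_op n [] = (\<lambda>f\<in>carrier_vec n. 0\<^sub>v n)"
  by (rule ext) (auto simp: diff_op_def intro!: eq_vecI)

lemma map_pderiv_closed: "f \<in> carrier_vec n \<Longrightarrow> map_vec pderiv f \<in> carrier_vec n"
  for f :: "complex poly vec"
  by auto

lemma diff_op_Cons:
  assumes "A \<in> carrier_mat n n" "f \<in> carrier_vec n"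
  shows "diff_op n (A # As) f = A *\<^sub>v f + diff_op n As (map_vec pderiv f)"
proof (rule eq_vecI)
  fix i assume "i < dim_vec (A *\<^sub>v f + diff_op n As (map_vec pderiv f))"
  then have i: "i < n" using assms by (simp add: diff_op_def)
  have 1: "map_vec (pderiv ^^ 0) f = f" by (auto intro!: eq_vecI)
  have 2: "map_vec (pderiv ^^ Suc j) f = map_vec (pderiv ^^ j) (map_vec pderiv f)" for j
    by (rule eq_vecI) (auto simp: funpow_Suc_right simp del: funpow.simps)
  show "diff_op n (A # As) f $ i = (A *\<^sub>v f + diff_op n As (map_vec pderiv f)) $ i"
    using assms i
    by (simp add: diff_op_def sum.lessThan_Suc_shift 1 2
        del: sum.lessThan_Suc funpow.simps index_mult_mat_vec)
qed (use assms in \<open>simp add: diff_op_def\<close>)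

lemma diff_op_add:
  assumes "set As \<subseteq> carrier_mat n n" "set Bs \<subseteq> carrier_mat n n"
  shows "\<exists>Cs. set Cs \<subseteq> carrier_mat n n \<and>
           (\<forall>f\<in>carrier_vec n. diff_op n Cs f = diff_op n As f + diff_op n Bs f)"
  using assms
proof (induction As arbitrary: Bs)
  case Nil
  then show ?case
    by (intro exI[of _ Bs]) (auto simp: diff_op_Nil diff_op_closed)
next
  case (Cons A As)
  show ?case
  proof (cases Bs)
    case Nil
    then show ?thesis using Cons.prems
      by (intro exI[of _ "A # As"]) (auto simp: diff_op_Nil diff_op_closed)
  next
    case (Cons B Bs')
    obtain Cs where Cs: "set Cs \<subseteq> carrier_mat n n"
      "\<forall>f\<in>carrier_vec n. diff_op n Cs f = diff_op n As f + diff_op n Bs' f"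
      using Cons.IH[of Bs'] Cons.prems Cons by auto
    show ?thesis
    proof (intro exI[of _ "(A + B) # Cs"] conjI ballI)
      fix f :: "complex poly vec" assume f: "f \<in> carrier_vec n"
      have AB: "A \<in> carrier_mat n n" "B \<in> carrier_mat n n" using Cons.prems Cons by auto
      note cl = map_pderiv_closed[OF f]
      have v: "A *\<^sub>v f \<in> carrier_vec n" "B *\<^sub>v f \<in> carrier_vec n" using AB f by auto
      note d = diff_op_closed[OF cl, of As] diff_op_closed[OF cl, of Bs']
      show "diff_op n ((A + B) # Cs) f = diff_op n (A # As) f + diff_op n Bs f"
        unfolding Cons using AB f v d Cs(2) cl
        by (simp add: diff_op_Cons add_mult_distrib_mat_vec[of _ n n])
           (auto intro!: eq_vecI)
    qed (use Cs Cons.prems Cons in auto)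
  qed
qed

lemma diff_op_mat_mult:
  assumes "A \<in> carrier_mat n n" "set Bs \<subseteq> carrier_mat n n" "f \<in> carrier_vec n"
  shows "diff_op n (map ((*) A) Bs) f = A *\<^sub>v diff_op n Bs f"
  using assms(2,3)
proof (induction Bs arbitrary: f)
  case Nil
  then show ?case using assms(1) by (simp add: diff_op_Nil mult_mat_vec_def scalar_prod_def)
      (auto intro!: eq_vecI)
next
  case (Cons B Bs)
  have B: "B \<in> carrier_mat n n" "A * B \<in> carrier_mat n n" using Cons assms(1) by auto
  have v: "B *\<^sub>v f \<in> carrier_vec n" using B Cons.prems by auto
  note cl = map_pderiv_closed[OF Cons.prems(2)]
  show ?case using Cons B v cl assms(1) diff_op_closed[OF cl, of Bs]
    by (simp add: diff_op_Cons assoc_mult_mat_vec[of _ n n _ n] mult_add_distrib_mat_vec[of _ n n])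
qed

lemma pderiv_mult_mat_vec:
  fixes B :: "complex poly mat"
  assumes "B \<in> carrier_mat n n" "f \<in> carrier_vec n"
  shows "map_vec pderiv (B *\<^sub>v f) = map_mat pderiv B *\<^sub>v f + B *\<^sub>v map_vec pderiv f"
  using assms
  by (intro eq_vecI)
     (auto simp: scalar_prod_def higher_pderiv_sum[of 1, simplified] pderiv_mult sum.distrib[symmetric] algebra_simps
           intro!: sum.cong)

lemma pderiv_diff_op:
  assumes "set Bs \<subseteq> carrier_mat n n"
  shows "\<exists>Cs. set Cs \<subseteq> carrier_mat n n \<and>
           (\<forall>f\<in>carrier_vec n. diff_op n Cs f = map_vec pderiv (diff_op n Bs f))"
  using assms
proof (induction Bs)
  case Nil
  show ?case by (intro exI[of _ "[]"]) (auto simp: diff_op_Nil intro!: eq_vecI)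
next
  case (Cons B Bs)
  then obtain Cs where Cs: "set Cs \<subseteq> carrier_mat n n"
    "\<forall>f\<in>carrier_vec n. diff_op n Cs f = map_vec pderiv (diff_op n Bs f)" by auto
  have B: "B \<in> carrier_mat n n" using Cons by auto
  have B': "map_mat pderiv B \<in> carrier_mat n n" using B by auto
  obtain Es where Es: "set Es \<subseteq> carrier_mat n n"
    "\<forall>f\<in>carrier_vec n. diff_op n Es f
       = diff_op n [map_mat pderiv B, B] f + diff_op n (0\<^sub>m n n # Cs) f"
    using diff_op_add[of "[map_mat pderiv B, B]" n "0\<^sub>m n n # Cs"] B B' Cs by auto
  show ?case
  proof (intro exI[of _ Es] conjI ballI)
    fix f :: "complex poly vec" assume f: "f \<in> carrier_vec n"
    note cl = map_pderiv_closed[OF f]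
    note d = diff_op_closed[OF cl, of Bs]
    note cl2 = map_pderiv_closed[OF d] map_pderiv_closed[OF cl]
    have v: "B *\<^sub>v f \<in> carrier_vec n" "B *\<^sub>v map_vec pderiv f \<in> carrier_vec n"
      "map_mat pderiv B *\<^sub>v f \<in> carrier_vec n"
      using B B' f cl by auto
    have z: "0\<^sub>m n n *\<^sub>v f = 0\<^sub>v n" using f by (intro eq_vecI) auto
    have "map_vec pderiv (diff_op n (B # Bs) f)
        = map_vec pderiv (B *\<^sub>v f) + map_vec pderiv (diff_op n Bs (map_vec pderiv f))"
      using v d B f by (simp add: diff_op_Cons) (auto intro!: eq_vecI simp: pderiv_add)
    also have "\<dots> = diff_op n Es f"
      using Es(2) f B B' Cs(2) cl cl2 v z
      by (simp add: diff_op_Cons diff_op_Nil pderiv_mult_mat_vec)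
    finally show "diff_op n Es f = map_vec pderiv (diff_op n (B # Bs) f)" ..
  qed (use Es in auto)
qed

lemma diff_op_compose:
  assumes "set As \<subseteq> carrier_mat n n" "set Bs \<subseteq> carrier_mat n n"
  shows "\<exists>Cs. set Cs \<subseteq> carrier_mat n n \<and>
           (\<forall>f\<in>carrier_vec n. diff_op n Cs f = diff_op n As (diff_op n Bs f))"
  using assms
proof (induction As arbitrary: Bs)
  case Nil
  show ?case by (intro exI[of _ "[]"]) (auto simp: diff_op_Nil diff_op_closed)
next
  case (Cons A As)
  have A: "A \<in> carrier_mat n n" using Cons by auto
  obtain Bs' where Bs': "set Bs' \<subseteq> carrier_mat n n"
    "\<forall>f\<in>carrier_vec n. diff_op n Bs' f = map_vec pderiv (diff_op n Bs f)"
    using pderiv_diff_op[OF Cons.prems(2)] by auto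
  obtain Cs where Cs: "set Cs \<subseteq> carrier_mat n n"
    "\<forall>f\<in>carrier_vec n. diff_op n Cs f = diff_op n As (diff_op n Bs' f)"
    using Cons.IH[of Bs'] Cons.prems Bs' by auto
  have AB: "set (map ((*) A) Bs) \<subseteq> carrier_mat n n" using A Cons.prems by auto
  obtain Es where Es: "set Es \<subseteq> carrier_mat n n"
    "\<forall>f\<in>carrier_vec n. diff_op n Es f = diff_op n (map ((*) A) Bs) f + diff_op n Cs f"
    using diff_op_add[OF AB Cs(1)] by auto
  then show ?case
    using A Cons.prems Cs Bs'
    by (intro exI[of _ Es]) (auto simp: diff_op_Cons diff_op_closed diff_op_mat_mult)
qed

lemma diff_op_mult_add:
  assumes "f \<in> carrier_vec n" "g \<in> carrier_vec n" "set As \<subseteq> carrier_mat n n"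
  shows "diff_op n As (f + g) = diff_op n As f + diff_op n As g"
  using assms
proof (induction As arbitrary: f g)
  case Nil
  then show ?case by (simp add: diff_op_Nil)
next
  case (Cons A As)
  have "map_vec pderiv (f + g) = map_vec pderiv f + map_vec pderiv g"
    using Cons.prems by (intro eq_vecI) (auto simp: pderiv_add)
  moreover have "A *\<^sub>v f \<in> carrier_vec n" "A *\<^sub>v g \<in> carrier_vec n"
    using Cons.prems by auto
  moreover note cl = map_pderiv_closed[OF Cons.prems(1)] map_pderiv_closed[OF Cons.prems(2)]
  ultimately show ?case
    using Cons.prems Cons.IH[OF cl] diff_op_closed[OF cl(1), of As] diff_op_closed[OF cl(2), of As]
    by (simp add: diff_op_Cons mult_add_distrib_mat_vec[of _ n n]) (auto intro!: eq_vecI)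
qed

lemma diff_op_extI:
  assumes "\<And>f. f \<in> carrier_vec n \<Longrightarrow> diff_op n As f = F f"
  shows "diff_op n As = (\<lambda>f\<in>carrier_vec n. F f)"
  using assms by (intro ext) (auto simp: diff_op_def)

lemma scalar_op_eq: "scalar_op n c = diff_op n [[:c:] \<cdot>\<^sub>m 1\<^sub>m n]"
  unfolding scalar_op_def
proof (rule diff_op_extI[symmetric])
  fix f :: "complex poly vec" assume f: "f \<in> carrier_vec n"
  then have "([:c:] \<cdot>\<^sub>m 1\<^sub>m n) *\<^sub>v f = [:c:] \<cdot>\<^sub>v f"
    by (intro eq_vecI) (auto simp: scalar_prod_smult_left)
  then show "diff_op n [[:c:] \<cdot>\<^sub>m 1\<^sub>m n] f = [:c:] \<cdot>\<^sub>v f"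
    using f by (simp add: diff_op_Cons diff_op_Nil map_pderiv_closed)
qed

lemma one_diff_op: "(\<lambda>f\<in>carrier_vec n. f) = diff_op n [1\<^sub>m n]"
  by (rule diff_op_extI[symmetric]) (auto simp: diff_op_Cons diff_op_Nil map_pderiv_closed)

lemma zero_diff_op: "(\<lambda>f\<in>carrier_vec n. 0\<^sub>v n) = diff_op n []"
  by (simp add: diff_op_Nil)

lemma diff_op_eqI:
  assumes "\<And>f. f \<in> carrier_vec n \<Longrightarrow> diff_op n As f = diff_op n Bs f"
  shows "diff_op n As = diff_op n Bs"
  using assms by (intro ext) (auto simp: diff_op_def restrict_def)

lemma diff_op_carrier: "set As \<subseteq> carrier_mat n n \<Longrightarrow> diff_op n As \<in> carrier (diff_op_ring n)"
  by (auto simp: diff_op_ring_def)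

lemma diff_op_add_carrier:
  assumes "F \<in> carrier (diff_op_ring n)" "G \<in> carrier (diff_op_ring n)"
  shows "F \<oplus>\<^bsub>diff_op_ring n\<^esub> G \<in> carrier (diff_op_ring n)"
proof -
  obtain As Bs where *: "F = diff_op n As" "G = diff_op n Bs"
    "set As \<subseteq> carrier_mat n n" "set Bs \<subseteq> carrier_mat n n"
    using assms by (auto simp: diff_op_ring_def)
  obtain Cs where Cs: "set Cs \<subseteq> carrier_mat n n"
    "\<forall>f\<in>carrier_vec n. diff_op n Cs f = diff_op n As f + diff_op n Bs f"
    using diff_op_add[OF *(3,4)] by auto
  then have "diff_op n Cs = F \<oplus>\<^bsub>diff_op_ring n\<^esub> G"
    using * diff_op_extI[of n Cs "\<lambda>f. F f + G f"] by (simp add: diff_op_ring_def)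
  then show ?thesis using diff_op_carrier[OF Cs(1)] by simp
qed

lemma diff_op_mult_carrier:
  assumes "F \<in> carrier (diff_op_ring n)" "G \<in> carrier (diff_op_ring n)"
  shows "F \<otimes>\<^bsub>diff_op_ring n\<^esub> G \<in> carrier (diff_op_ring n)"
proof -
  obtain As Bs where *: "F = diff_op n As" "G = diff_op n Bs"
    "set As \<subseteq> carrier_mat n n" "set Bs \<subseteq> carrier_mat n n"
    using assms by (auto simp: diff_op_ring_def)
  obtain Cs where Cs: "set Cs \<subseteq> carrier_mat n n"
    "\<forall>f\<in>carrier_vec n. diff_op n Cs f = diff_op n As (diff_op n Bs f)"
    using diff_op_compose[OF *(3,4)] by auto
  then have "diff_op n Cs = F \<otimes>\<^bsub>diff_op_ring n\<^esub> G"
    using * diff_op_extI[of n Cs "\<lambda>f. F (G f)"] by (simp add: diff_op_ring_def compose_def)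
  then show ?thesis using diff_op_carrier[OF Cs(1)] by simp
qed

lemma scalar_op_carrier: "scalar_op n c \<in> carrier (diff_op_ring n)"
  by (auto simp: scalar_op_eq diff_op_ring_def intro!: exI[of _ "[[:c:] \<cdot>\<^sub>m 1\<^sub>m n]"])

lemma diff_op_mem_closed:
  assumes "F \<in> carrier (diff_op_ring n)" "f \<in> carrier_vec n"
  shows "F f \<in> carrier_vec n"
  using assms by (auto simp: diff_op_ring_def diff_op_closed)

lemma diff_op_mem_ext:
  assumes "F \<in> carrier (diff_op_ring n)"
  shows "(\<lambda>f\<in>carrier_vec n. F f) = F"
  using assms by (auto simp: diff_op_ring_def diff_op_def)

lemma diff_op_mem_add:
  assumes "F \<in> carrier (diff_op_ring n)" "f \<in> carrier_vec n" "g \<in> carrier_vec n"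
  shows "F (f + g) = F f + F g"
  using assms by (auto simp: diff_op_ring_def diff_op_mult_add)

lemma diff_op_ring_add: "F \<oplus>\<^bsub>diff_op_ring n\<^esub> G = (\<lambda>f\<in>carrier_vec n. F f + G f)"
  and diff_op_ring_mult: "F \<otimes>\<^bsub>diff_op_ring n\<^esub> G = (\<lambda>f\<in>carrier_vec n. F (G f))"
  and diff_op_ring_zero: "\<zero>\<^bsub>diff_op_ring n\<^esub> = (\<lambda>f\<in>carrier_vec n. 0\<^sub>v n)"
  and diff_op_ring_one: "\<one>\<^bsub>diff_op_ring n\<^esub> = (\<lambda>f\<in>carrier_vec n. f)"
  by (simp_all add: diff_op_ring_def compose_def)

lemma ring_diff_op_ring: "ring (diff_op_ring n)"
proof (rule ringI)
  let ?R = "diff_op_ring n"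
  note ops = diff_op_ring_add diff_op_ring_mult diff_op_ring_zero diff_op_ring_one
  have zero: "\<zero>\<^bsub>?R\<^esub> \<in> carrier ?R"
    by (auto simp: diff_op_ring_def zero_diff_op intro!: exI[of _ "[]"])
  have one: "\<one>\<^bsub>?R\<^esub> \<in> carrier ?R"
    by (auto simp: diff_op_ring_def one_diff_op intro!: exI[of _ "[1\<^sub>m n]"])
  show "abelian_group ?R"
  proof (rule abelian_groupI)
    fix F G H assume F: "F \<in> carrier ?R" and G: "G \<in> carrier ?R" and H: "H \<in> carrier ?R"
    show "(F \<oplus>\<^bsub>?R\<^esub> G) \<oplus>\<^bsub>?R\<^esub> H = F \<oplus>\<^bsub>?R\<^esub> (G \<oplus>\<^bsub>?R\<^esub> H)"
      unfolding ops using diff_op_mem_closed[OF F] diff_op_mem_closed[OF G] diff_op_mem_closed[OF H]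
      by (intro restrict_ext) (simp add: assoc_add_vec[of _ n])
  next
    fix F G assume F: "F \<in> carrier ?R" and G: "G \<in> carrier ?R"
    show "F \<oplus>\<^bsub>?R\<^esub> G = G \<oplus>\<^bsub>?R\<^esub> F"
      unfolding ops using diff_op_mem_closed[OF F] diff_op_mem_closed[OF G]
      by (intro restrict_ext) (simp add: comm_add_vec[of _ n])
  next
    fix F assume F: "F \<in> carrier ?R"
    have "\<zero>\<^bsub>?R\<^esub> \<oplus>\<^bsub>?R\<^esub> F = (\<lambda>f\<in>carrier_vec n. F f)"
      unfolding ops using diff_op_mem_closed[OF F] by (intro restrict_ext) simp
    then show "\<zero>\<^bsub>?R\<^esub> \<oplus>\<^bsub>?R\<^esub> F = F" using diff_op_mem_ext[OF F] by simp
    have neg: "[:-1:] \<cdot>\<^sub>v v + v = 0\<^sub>v n" if "v \<in> carrier_vec n" for v :: "complex poly vec"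
      using that by (intro eq_vecI) auto
    have "(scalar_op n (-1) \<otimes>\<^bsub>?R\<^esub> F) \<oplus>\<^bsub>?R\<^esub> F = \<zero>\<^bsub>?R\<^esub>"
      unfolding ops scalar_op_def using diff_op_mem_closed[OF F]
      by (intro restrict_ext) (simp add: neg)
    then show "\<exists>G\<in>carrier ?R. G \<oplus>\<^bsub>?R\<^esub> F = \<zero>\<^bsub>?R\<^esub>"
      using diff_op_mult_carrier[OF scalar_op_carrier F] by blast
  qed (auto simp: zero intro: diff_op_add_carrier)
  show "Group.monoid ?R"
  proof (rule monoidI)
    fix F G H assume F: "F \<in> carrier ?R" and G: "G \<in> carrier ?R" and H: "H \<in> carrier ?R"
    show "(F \<otimes>\<^bsub>?R\<^esub> G) \<otimes>\<^bsub>?R\<^esub> H = F \<otimes>\<^bsub>?R\<^esub> (G \<otimes>\<^bsub>?R\<^esub> H)"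
      unfolding ops using diff_op_mem_closed[OF H] by (intro restrict_ext) simp
  next
    fix F assume F: "F \<in> carrier ?R"
    have "\<one>\<^bsub>?R\<^esub> \<otimes>\<^bsub>?R\<^esub> F = (\<lambda>f\<in>carrier_vec n. F f)"
      unfolding ops using diff_op_mem_closed[OF F] by (intro restrict_ext) simp
    then show "\<one>\<^bsub>?R\<^esub> \<otimes>\<^bsub>?R\<^esub> F = F" using diff_op_mem_ext[OF F] by simp
    have "F \<otimes>\<^bsub>?R\<^esub> \<one>\<^bsub>?R\<^esub> = (\<lambda>f\<in>carrier_vec n. F f)"
      unfolding ops by (intro restrict_ext) simp
    then show "F \<otimes>\<^bsub>?R\<^esub> \<one>\<^bsub>?R\<^esub> = F" using diff_op_mem_ext[OF F] by simp
  qed (auto simp: one intro: diff_op_mult_carrier)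
next
  let ?R = "diff_op_ring n"
  note ops = diff_op_ring_add diff_op_ring_mult
  fix F G H assume F: "F \<in> carrier ?R" and G: "G \<in> carrier ?R" and H: "H \<in> carrier ?R"
  show "(F \<oplus>\<^bsub>?R\<^esub> G) \<otimes>\<^bsub>?R\<^esub> H = F \<otimes>\<^bsub>?R\<^esub> H \<oplus>\<^bsub>?R\<^esub> G \<otimes>\<^bsub>?R\<^esub> H"
    unfolding ops using diff_op_mem_closed[OF H] by (intro restrict_ext) simp
  show "H \<otimes>\<^bsub>?R\<^esub> (F \<oplus>\<^bsub>?R\<^esub> G) = H \<otimes>\<^bsub>?R\<^esub> F \<oplus>\<^bsub>?R\<^esub> H \<otimes>\<^bsub>?R\<^esub> G"
    unfolding ops
    using diff_op_mem_closed[OF F] diff_op_mem_closed[OF G] diff_op_mem_add[OF H]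
    by (intro restrict_ext) simp
qed

lemma const_mat_closed: "const_mat n a \<in> carrier_mat n n"
  by (simp add: const_mat_def)

lemma opD_carrier: "opD l \<alpha> \<beta> k \<in> carrier (diff_op_ring (l + 1))"
  unfolding opD_def matC_def matU_def matV_def
  by (rule diff_op_carrier) (auto intro!: const_mat_closed minus_carrier_mat smult_carrier_mat)

lemma opE_carrier: "opE l \<alpha> \<beta> k \<in> carrier (diff_op_ring (l + 1))"
  unfolding opE_def matV_def matQ0_def matQ1_def matP0_def matP1_def
  by (rule diff_op_carrier) (auto intro!: const_mat_closed add_carrier_mat smult_carrier_mat)

end

theory Submission
  imports Defs "HOL-Analysis.Continuum_Not_Denumerable"
begin

text \<open>
  The two operators commute, and in suitable coordinates both are triangular. Enumerate the basis
  \<open>u\<^sup>m e\<^sub>i\<close> of the vector valued polynomials lexicographically, first by the degree \<open>m\<close> and then by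
  \<open>i\<close>. Neither operator produces a basis vector above the one it is applied to, so each has a
  sequence of diagonal entries. The entries \<open>x\<close> of \<open>D\<close> and \<open>y\<close> of \<open>E\<close> at \<open>(m, i)\<close> satisfy
  \<open>y = (\<alpha> - l + 3 i) x - 3 i (l - i + k) (i + \<alpha> + \<beta> - k + 1)\<close>, whatever \<open>m\<close> is: they lie on the
  \<open>i\<close>-th of the \<open>l + 1\<close> lines whose union is the curve \<open>Q = 0\<close>.

  Both halves of the statement come from this. If \<open>p(D, E) = 0\<close>, then \<open>p\<close> vanishes at every pair of
  diagonal entries. On each line these pairs are infinitely many, so \<open>p\<close> vanishes on all the lines;
  their slopes differ, and therefore \<open>Q\<close> divides \<open>p\<close> (\<open>polyQ_dvdI\<close>).

  Conversely, \<open>Q(D, E)\<close> is triangular with zero diagonal and commutes with \<open>D\<close>. If the diagonal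
  entries of \<open>D\<close> are pairwise distinct, this forces \<open>Q(D, E) = 0\<close>
  (\<open>triangular_commuting_zero\<close>): applied to a vector with top coordinate \<open>N\<close>, such an operator
  would produce an eigenvector of \<open>D\<close> whose eigenvalue is the \<open>N\<close>-th diagonal entry but whose top
  coordinate is lower. For fixed \<open>\<beta>\<close> and \<open>k > 0\<close>, two diagonal entries of \<open>D\<close> agree for at most one
  \<open>\<alpha>\<close>, so they are pairwise distinct outside a countable set of \<open>\<alpha>\<close>. The coordinates of
  \<open>Q(D, E) f\<close> are continuous in \<open>\<alpha>\<close>, and hence vanish for the exceptional \<open>\<alpha>\<close> as well
  (\<open>polyQ_annihilates\<close>).

  So the kernel of the surjection \<open>p \<mapsto> p(D, E)\<close> from \<open>\<complex>[x,y]\<close> onto the generated algebra is the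
  ideal of \<open>Q\<close>. That this map exists rests on \<open>D E = E D\<close>, an identity between the recurrences that
  describe the operators on coefficients (\<open>actD_actE_commute\<close>).
\<close>

section \<open>Substitution into polynomials in a noncommutative ring\<close>

text \<open>
  A ring homomorphism \<open>c\<close> on the coefficients and an element commuting with its image extend to a
  homomorphism on polynomials. The target ring may be noncommutative, as operator rings are, and \<open>c\<close>
  may itself be a substitution, which gives polynomials in two variables.
\<close>

locale poly_subst = ring R for R (structure) +
  fixes c :: "'c::comm_ring_1 \<Rightarrow> 'a" and x :: 'a
  assumes c_closed: "c a \<in> carrier R"
    and c_add: "c (a + b) = c a \<oplus> c b"
    and c_mult: "c (a * b) = c a \<otimes> c b"
    and c_one: "c 1 = \<one>"
    and x_closed: "x \<in> carrier R"
    and x_commute: "c a \<otimes> x = x \<otimes> c a"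
begin

definition subst :: "'c poly \<Rightarrow> 'a" where
  "subst p = foldr (\<lambda>a r. c a \<oplus> x \<otimes> r) (coeffs p) \<zero>"

lemma c_zero: "c 0 = \<zero>"
proof -
  have "c 0 \<oplus> c 0 = c 0" using c_add[of 0 0] by simp
  then show ?thesis using c_closed[of 0] by (metis add.r_cancel_one)
qed

lemma subst_0: "subst 0 = \<zero>"
  by (simp add: subst_def)

lemma subst_pCons: "subst (pCons a p) = c a \<oplus> x \<otimes> subst p"
  by (cases "a = 0 \<and> p = 0") (auto simp: subst_def c_zero x_closed cCons_def)

lemma subst_closed: "subst p \<in> carrier R"
  by (induction p) (simp_all add: subst_0 subst_pCons c_closed x_closed)

lemma subst_const: "subst [:a:] = c a"
  by (simp add: subst_pCons subst_0 c_closed x_closed)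

lemma subst_var: "subst [:0, 1:] = x"
  by (simp add: subst_pCons subst_0 c_zero c_one x_closed)

lemma subst_add: "subst (p + q) = subst p \<oplus> subst q"
proof (induction p q rule: poly_induct2)
  case (pCons a p b q)
  then show ?case
    by (simp add: subst_pCons c_add r_distr x_closed subst_closed c_closed a_ac)
qed (simp add: subst_0)

lemma subst_smult: "subst (smult a p) = c a \<otimes> subst p"
proof (induction p)
  case (pCons b p)
  have "c a \<otimes> (x \<otimes> subst p) = x \<otimes> (c a \<otimes> subst p)"
    using x_commute[of a] by (metis c_closed m_assoc subst_closed x_closed)
  then show ?case using pCons
    by (simp add: subst_pCons c_mult r_distr x_closed subst_closed c_closed)
qed (simp add: subst_0 c_closed)

lemma subst_mult: "subst (p * q) = subst p \<otimes> subst q"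
proof (induction p)
  case (pCons a p)
  then show ?case
    by (simp add: subst_add subst_smult subst_pCons[of 0] subst_pCons[of a] c_zero l_distr
        x_closed subst_closed c_closed m_assoc)
qed (simp add: subst_0 subst_closed)

lemma subst_commute:
  assumes "y \<in> carrier R" "\<And>a. c a \<otimes> y = y \<otimes> c a" "x \<otimes> y = y \<otimes> x"
  shows "subst p \<otimes> y = y \<otimes> subst p"
proof (induction p)
  case (pCons a p)
  have "(x \<otimes> subst p) \<otimes> y = y \<otimes> (x \<otimes> subst p)"
    using pCons assms by (metis m_assoc subst_closed x_closed)
  then show ?case
    using assms by (simp add: subst_pCons l_distr r_distr x_closed subst_closed c_closed)
qed (simp add: subst_0 assms)

lemma subst_in_subring:
  assumes "subring H R" "range c \<subseteq> H" "x \<in> H"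
  shows "subst p \<in> H"
proof (induction p)
  case (pCons a p)
  moreover have "c a \<in> H" using assms(2) by blast
  ultimately show ?case
    using assms(3) subringE(6,7)[OF assms(1)] by (simp add: subst_pCons)
qed (simp add: subst_0 subringE(2)[OF assms(1)])

end

section \<open>The operators on coefficients\<close>

text \<open>
  All coefficient matrices are tridiagonal, so one row of a product involves at most three components
  of the vector.
\<close>

lemma const_mat_band_mult:
  assumes f: "f \<in> carrier_vec n" and i: "i < n"
    and a: "\<And>j. j < n \<Longrightarrow> a (i, j) = (if j = i then d else 0) + (if j = Suc i then e else 0)
                                 + (if Suc j = i then g else 0)"
  shows "(const_mat n a *\<^sub>v f) $ i = smult (of_real d) (f $ i)
      + (if Suc i < n then smult (of_real e) (f $ Suc i) else 0)
      + (if 0 < i then smult (of_real g) (f $ (i - 1)) else 0)"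
proof -
  have "(const_mat n a *\<^sub>v f) $ i = (\<Sum>j=0..<n. smult (of_real (a (i, j))) (f $ j))"
    using f i by (simp add: const_mat_def scalar_prod_def)
  also have "\<dots> = (\<Sum>j=0..<n. (if j = i then smult (of_real d) (f $ j) else 0))
      + (\<Sum>j=0..<n. (if j = Suc i then smult (of_real e) (f $ j) else 0))
      + (\<Sum>j=0..<n. (if j = i - 1 then (if 0 < i then smult (of_real g) (f $ j) else 0) else 0))"
    unfolding sum.distrib[symmetric] by (intro sum.cong refl) (auto simp: a smult_add_left)
  finally show ?thesis using i by (simp add: sum.delta less_imp_diff_less)
qed

lemma sum_munit_diag:
  "(\<Sum>i=0..l. h i * munit i i (r, s)) = (if r = s \<and> r \<le> l then h r else 0)"
proof -
  have "(\<Sum>i=0..l. h i * munit i i (r, s)) = (\<Sum>i=0..l. if i = r then (if r = s then h r else 0) else 0)"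
    by (intro sum.cong refl) (auto simp: munit_def)
  then show ?thesis by (simp add: sum.delta)
qed

lemma sum_munit_lower:
  "(\<Sum>i=0..l. real i * h i * munit i (i - 1) (r, s)) = (if Suc s = r \<and> r \<le> l then real r * h r else 0)"
proof -
  have "(\<Sum>i=0..l. real i * h i * munit i (i - 1) (r, s))
      = (\<Sum>i=0..l. if i = r then (if Suc s = r then real r * h r else 0) else 0)"
    by (intro sum.cong refl) (auto simp: munit_def)
  then show ?thesis by (simp add: sum.delta)
qed

lemma sum_munit_upper:
  "(\<Sum>i=0..l. h i * munit i (i + 1) (r, s)) = (if s = Suc r \<and> r \<le> l then h r else 0)"
proof -
  have "(\<Sum>i=0..l. h i * munit i (i + 1) (r, s)) = (\<Sum>i=0..l. if i = r then (if s = Suc r then h r else 0) else 0)"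
    by (intro sum.cong refl) (auto simp: munit_def)
  then show ?thesis by (simp add: sum.delta)
qed

lemma matU_mult:
  assumes "f \<in> carrier_vec (l + 1)" "i \<le> l"
  shows "(matU l \<alpha> \<beta> *\<^sub>v f) $ i = smult (of_real (\<alpha> + \<beta> + real l + real i + 2)) (f $ i)"
  unfolding matU_def
  by (subst const_mat_band_mult[where d = "\<alpha> + \<beta> + real l + real i + 2" and e = 0 and g = 0])
    (use assms in \<open>unfold sum_munit_diag, auto\<close>)

lemma matC_mult:
  assumes "f \<in> carrier_vec (l + 1)" "i \<le> l"
  shows "(matC l \<beta> *\<^sub>v f) $ i = smult (of_real (\<beta> + 1 + 2 * real i)) (f $ i)
     + smult (of_nat i) (f $ (i - 1))"
proof -
  have *: "(\<Sum>i=1..l. real i * munit i (i - 1) (r, s)) = (if Suc s = r \<and> r \<le> l then real r else 0)" for r s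
    using sum_munit_lower[of "\<lambda>_. 1" r s l] by (simp add: sum.atLeast_Suc_atMost)
  show ?thesis unfolding matC_def
    by (subst const_mat_band_mult[where d = "\<beta> + 1 + 2 * real i" and e = 0 and g = "real i"])
      (use assms in \<open>unfold sum_munit_diag *, auto\<close>)
qed

lemma matV_mult:
  assumes "f \<in> carrier_vec (l + 1)" "i \<le> l"
  shows "(matV l \<alpha> \<beta> k *\<^sub>v f) $ i = smult (of_real (real i * (\<alpha> + \<beta> - k + 1 + real i))) (f $ i)
     - (if i < l then smult (of_real ((real l - real i) * (\<beta> - k + 1 + real i))) (f $ Suc i) else 0)"
proof -
  have *: "(\<Sum>i<l. (real l - real i) * (\<beta> - k + 1 + real i) * munit i (i + 1) (r, s))
    = (if s = Suc r \<and> r \<le> l then (real l - real r) * (\<beta> - k + 1 + real r) else 0)" for r s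
    using sum_munit_upper[of "\<lambda>i. (real l - real i) * (\<beta> - k + 1 + real i)" r s l]
    by (simp add: atLeast0AtMost lessThan_Suc_atMost[symmetric])
  show ?thesis unfolding matV_def
    by (subst const_mat_band_mult[where d = "real i * (\<alpha> + \<beta> - k + 1 + real i)"
      and e = "- ((real l - real i) * (\<beta> - k + 1 + real i))" and g = 0])
      (use assms in \<open>unfold sum_munit_diag *, auto\<close>)
qed

lemma matQ0_mult:
  assumes "f \<in> carrier_vec (l + 1)" "i \<le> l"
  shows "(matQ0 l *\<^sub>v f) $ i = smult (of_real (3 * real i)) (f $ (i - 1))"
proof -
  have *: "(\<Sum>i=0..l. 3 * real i * munit i (i - 1) (r, s)) = (if Suc s = r \<and> r \<le> l then 3 * real r else 0)" for r s
    using sum_munit_lower[of "\<lambda>_. 3" r s l] by (simp add: mult.commute[of _ 3])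
  show ?thesis unfolding matQ0_def
    by (subst const_mat_band_mult[where d = 0 and e = 0 and g = "3 * real i"])
      (use assms in \<open>unfold *, auto\<close>)
qed

lemma matQ1_mult:
  assumes "f \<in> carrier_vec (l + 1)" "i \<le> l"
  shows "(matQ1 l \<alpha> *\<^sub>v f) $ i = smult (of_real (\<alpha> - real l + 3 * real i)) (f $ i)"
  unfolding matQ1_def
  by (subst const_mat_band_mult[where d = "\<alpha> - real l + 3 * real i" and e = 0 and g = 0])
    (use assms in \<open>unfold sum_munit_diag, auto\<close>)

lemma matP0_mult:
  assumes "f \<in> carrier_vec (l + 1)" "i \<le> l"
  shows "(matP0 l \<alpha> \<beta> k *\<^sub>v f) $ i
    = smult (of_real ((\<alpha> + 2 * real l) * (\<beta> + 1 + 2 * real i) - 3 * k * (real l - real i)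
                  - 3 * real i * (\<beta> - k + real i))) (f $ i)
     - smult (of_real (real i * (3 * real i + 3 * \<beta> - 3 * k + 3 + real l + 2 * \<alpha>))) (f $ (i - 1))"
  unfolding matP0_def
  by (subst const_mat_band_mult[where d = "(\<alpha> + 2 * real l) * (\<beta> + 1 + 2 * real i) - 3 * k * (real l - real i)
                - 3 * real i * (\<beta> - k + real i)" and e = 0
               and g = "- (real i * (3 * real i + 3 * \<beta> - 3 * k + 3 + real l + 2 * \<alpha>))"])
    (use assms in \<open>unfold sum_munit_diag sum_munit_lower, auto\<close>)

lemma matP1_mult:
  assumes "f \<in> carrier_vec (l + 1)" "i \<le> l"
  shows "(matP1 l \<alpha> \<beta> k *\<^sub>v f) $ i
    = (if i < l then smult (of_real (3 * (\<beta> - k + 1 + real i) * (real l - real i))) (f $ Suc i) else 0)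
      - smult (of_real ((\<alpha> - real l + 3 * real i) * (\<alpha> + \<beta> + real l + real i + 2))) (f $ i)"
  unfolding matP1_def
  by (subst const_mat_band_mult[where d = "- ((\<alpha> - real l + 3 * real i) * (\<alpha> + \<beta> + real l + real i + 2))"
     and g = 0 and e = "3 * (\<beta> - k + 1 + real i) * (real l - real i)"])
    (use assms in \<open>unfold sum_munit_diag sum_munit_upper, auto\<close>)

text \<open>
  The diagonal entry of \<open>D\<close> at \<open>u\<^sup>m e\<^sub>i\<close>. Here and below \<open>L\<close> stands for the number \<open>l\<close> in the
  coefficient ring.
\<close>

definition eigD :: "'a::comm_ring_1 \<Rightarrow> 'a \<Rightarrow> 'a \<Rightarrow> 'a \<Rightarrow> nat \<Rightarrow> nat \<Rightarrow> 'a" where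
  "eigD \<alpha> \<beta> k L m i = of_nat m * (1 - of_nat m) - of_nat m * (\<alpha> + \<beta> + L + of_nat i + 2)
     - of_nat i * (\<alpha> + \<beta> - k + 1 + of_nat i)"

text \<open>
  The diagonal entries of \<open>E\<close> are \<open>slope * x - shift\<close>, where \<open>x\<close> is the diagonal entry of \<open>D\<close> at the
  same place; slope and shift depend on \<open>i\<close> only.
\<close>

definition slope :: "'a::comm_ring_1 \<Rightarrow> 'a \<Rightarrow> nat \<Rightarrow> 'a" where
  "slope \<alpha> L i = \<alpha> - L + 3 * of_nat i"

definition shift :: "'a::comm_ring_1 \<Rightarrow> 'a \<Rightarrow> 'a \<Rightarrow> 'a \<Rightarrow> nat \<Rightarrow> 'a" where
  "shift \<alpha> \<beta> k L i = 3 * of_nat i * (L - of_nat i + k) * (of_nat i + \<alpha> + \<beta> - k + 1)"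

text \<open>
  The operators as recurrences on arrays \<open>a m i\<close>, the coefficient of \<open>u\<^sup>m\<close> in the \<open>i\<close>-th component.
  The factors \<open>L - of_nat i\<close> and \<open>of_nat i\<close> switch off the neighbours that lie outside the matrix, so
  no case distinction is needed at \<open>i = 0\<close>, where \<open>i - 1\<close> is truncated, or at \<open>i = l\<close>.
\<close>

definition actD :: "'a::comm_ring_1 \<Rightarrow> 'a \<Rightarrow> 'a \<Rightarrow> 'a \<Rightarrow> (nat \<Rightarrow> nat \<Rightarrow> 'a)
    \<Rightarrow> nat \<Rightarrow> nat \<Rightarrow> 'a" where
  "actD \<alpha> \<beta> k L a m i = eigD \<alpha> \<beta> k L m i * a m i
     + (L - of_nat i) * (\<beta> - k + 1 + of_nat i) * a m (Suc i)
     + (of_nat m + 1) * (of_nat m + \<beta> + 1 + 2 * of_nat i) * a (Suc m) i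
     + (of_nat m + 1) * of_nat i * a (Suc m) (i - 1)"

definition actE :: "'a::comm_ring_1 \<Rightarrow> 'a \<Rightarrow> 'a \<Rightarrow> 'a \<Rightarrow> (nat \<Rightarrow> nat \<Rightarrow> 'a)
    \<Rightarrow> nat \<Rightarrow> nat \<Rightarrow> 'a" where
  "actE \<alpha> \<beta> k L a m i = (slope \<alpha> L i * eigD \<alpha> \<beta> k L m i - shift \<alpha> \<beta> k L i) * a m i
     + (L - of_nat i) * (\<beta> - k + 1 + of_nat i) * (3 * of_nat m + \<alpha> + 2 * L + 3 * k) * a m (Suc i)
     + (of_nat m + 1) * (of_nat m * slope \<alpha> L i + (\<alpha> + 2 * L) * (\<beta> + 1 + 2 * of_nat i)
          - 3 * k * (L - of_nat i) - 3 * of_nat i * (\<beta> - k + of_nat i)) * a (Suc m) i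
     - (of_nat m + 1) * of_nat i
          * (3 * of_nat m + 3 * of_nat i + 3 * \<beta> - 3 * k + 3 + L + 2 * \<alpha>) * a (Suc m) (i - 1)
     + (of_nat m + 2) * (of_nat m + 1) * 3 * of_nat i * a (Suc (Suc m)) (i - 1)"

text \<open>
  Put \<open>c = \<alpha> + 2 L + 3 k\<close>. Subtracting \<open>c D\<close> from \<open>E\<close> cancels the term in \<open>V\<close>, and
  \<open>E = c D - 3 F\<close> for an operator \<open>F\<close> with much simpler coefficients, so it is enough that \<open>D\<close> and
  \<open>F\<close> commute. Comparing the coefficients of the neighbours of \<open>(m, i)\<close> leaves ten polynomial
  identities in \<open>x = m\<close> and \<open>y = i\<close>.
\<close>

lemma actD_actE_commute:
  fixes \<alpha> \<beta> k L :: "'a::comm_ring_1"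
  shows "actD \<alpha> \<beta> k L (actE \<alpha> \<beta> k L a) m i = actE \<alpha> \<beta> k L (actD \<alpha> \<beta> k L a) m i"
proof -
  \<comment> \<open>The quantities \<open>r, h, w, s\<close> keep the identities short: each changes simply when \<open>x\<close> or \<open>y\<close> moves by 1.\<close>
  define r where "r y = L + k - y" for y :: 'a
  define w where "w y = \<alpha> + \<beta> + L + 1 - r y" for y :: 'a
  define h where "h x y = x + y + (\<alpha> + \<beta> + L + 1)" for x y :: 'a
  define d0 where "d0 x y = - (x * h x y) - y * w y" for x y :: 'a
  define d1 where "d1 y = (L - y) * (\<beta> - k + 1 + y)" for y :: 'a
  define d2 where "d2 x y = (x + 1) * (x + \<beta> + 1 + 2 * y)" for x y :: 'a
  define d3 where "d3 x y = (x + 1) * y" for x y :: 'a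
  define s where "s y = k * (\<beta> + 1 + L) + y * (\<beta> + y)" for y :: 'a
  define f0 where "f0 x y = - (r y * x * h x y)" for x y :: 'a
  define f1 where "f1 x y = - (d1 y * x)" for x y :: 'a
  define f2 where "f2 x y = (x + 1) * (x * r y + s y)" for x y :: 'a
  define f3 where "f3 x y = (x + 1) * y * h x y" for x y :: 'a
  define f4 where "f4 x y = - ((x + 2) * (x + 1) * y)" for x y :: 'a
  define F where "F b m i = f0 (of_nat m) (of_nat i) * b m i + f1 (of_nat m) (of_nat i) * b m (Suc i)
     + f2 (of_nat m) (of_nat i) * b (Suc m) i + f3 (of_nat m) (of_nat i) * b (Suc m) (i - 1)
     + f4 (of_nat m) (of_nat i) * b (Suc (Suc m)) (i - 1)" for b m i
  define c where "c = \<alpha> + 2 * L + 3 * k"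
  have D: "actD \<alpha> \<beta> k L b m i = d0 (of_nat m) (of_nat i) * b m i + d1 (of_nat i) * b m (Suc i)
     + d2 (of_nat m) (of_nat i) * b (Suc m) i + d3 (of_nat m) (of_nat i) * b (Suc m) (i - 1)" for b m i
  proof -
    have "eigD \<alpha> \<beta> k L m i = d0 (of_nat m) (of_nat i)"
      by (simp add: eigD_def d0_def h_def w_def r_def algebra_simps)
    then show ?thesis
      by (simp add: actD_def d1_def d2_def d3_def)
  qed
  have E: "actE \<alpha> \<beta> k L b m i = c * actD \<alpha> \<beta> k L b m i - 3 * F b m i" for b m i
  proof -
    have e0: "slope \<alpha> L i * eigD \<alpha> \<beta> k L m i - shift \<alpha> \<beta> k L i
        = c * d0 (of_nat m) (of_nat i) - 3 * f0 (of_nat m) (of_nat i)"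
      by (simp add: slope_def shift_def eigD_def d0_def f0_def h_def w_def r_def c_def algebra_simps)
    have e1: "(L - of_nat i) * (\<beta> - k + 1 + of_nat i) * (3 * of_nat m + \<alpha> + 2 * L + 3 * k)
        = c * d1 (of_nat i) - 3 * f1 (of_nat m) (of_nat i)"
      by (simp add: f1_def d1_def c_def algebra_simps)
    have e2: "(of_nat m + 1) * (of_nat m * slope \<alpha> L i + (\<alpha> + 2 * L) * (\<beta> + 1 + 2 * of_nat i)
          - 3 * k * (L - of_nat i) - 3 * of_nat i * (\<beta> - k + of_nat i))
        = c * d2 (of_nat m) (of_nat i) - 3 * f2 (of_nat m) (of_nat i)"
      by (simp add: d2_def f2_def s_def r_def c_def slope_def algebra_simps)
    have e3: "(of_nat m + 1) * of_nat i
          * (3 * of_nat m + 3 * of_nat i + 3 * \<beta> - 3 * k + 3 + L + 2 * \<alpha>)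
        = 3 * f3 (of_nat m) (of_nat i) - c * d3 (of_nat m) (of_nat i)"
      by (simp add: d3_def f3_def h_def c_def algebra_simps)
    have e4: "(of_nat m + 2) * (of_nat m + 1) * 3 * of_nat i = - 3 * f4 (of_nat m) (of_nat i)"
      by (simp add: f4_def algebra_simps)
    show ?thesis
      unfolding actE_def D F_def e0 e1 e2 e3 e4 by (simp add: algebra_simps)
  qed
  have r_step: "r (y + 1) = r y - 1" "r (y - 1) = r y + 1" for y
    by (simp_all add: r_def algebra_simps)
  have w_step: "w (y + 1) = w y + 1" "w (y - 1) = w y - 1" for y
    by (simp_all add: w_def r_def algebra_simps)
  have h_step: "h (x + 1) y = h x y + 1" "h x (y + 1) = h x y + 1" "h x (y - 1) = h x y - 1"
    "h (x + 2) y = h x y + 2" for x y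
    by (simp_all add: h_def algebra_simps)
  have s_step: "s (y + 1) = s y + (\<beta> + 2 * y + 1)" "s (y - 1) = s y - (\<beta> + 2 * y - 1)" for y
    by (simp_all add: s_def algebra_simps)
  \<comment> \<open>This ties \<open>s\<close>, a coefficient of \<open>F\<close>, to those of \<open>D\<close>; it makes the terms at \<open>(m + 1, i)\<close> and \<open>(m + 2, i)\<close> cancel.\<close>
  have key: "s y = (\<beta> + 1 + 2 * y) * r y - (y + 1) * d1 y + y * d1 (y - 1)" for y
    by (simp add: s_def r_def d1_def algebra_simps)
  note steps = r_step w_step h_step s_step
  \<comment> \<open>In the names below, the first digit is the shift of \<open>m\<close>, the rest that of \<open>i\<close>, with m for minus.\<close>
  have c01: "d0 x y * f1 x y + d1 y * f0 x (y + 1) = f0 x y * d1 y + f1 x y * d0 x (y + 1)" for x y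
    unfolding f0_def f1_def d0_def steps by (simp add: h_def w_def algebra_simps)
  have c02: "d1 y * f1 x (y + 1) = f1 x y * d1 (y + 1)" for x y
    by (simp add: f1_def)
  have c10: "d0 x y * f2 x y + d1 y * f3 x (y + 1) + d2 x y * f0 (x + 1) y + d3 x y * f1 (x + 1) (y - 1)
     = f0 x y * d2 x y + f1 x y * d3 x (y + 1) + f2 x y * d0 (x + 1) y + f3 x y * d1 (y - 1)" for x y
    unfolding f0_def f1_def f2_def f3_def d0_def d2_def d3_def steps key
    by (simp add: algebra_simps)
  have c11: "d1 y * f2 x (y + 1) + d2 x y * f1 (x + 1) y = f1 x y * d2 x (y + 1) + f2 x y * d1 y" for x y
    unfolding f1_def f2_def d2_def steps by (simp add: algebra_simps)
  have c1m: "d0 x y * f3 x y + d3 x y * f0 (x + 1) (y - 1) = f0 x y * d3 x y + f3 x y * d0 (x + 1) (y - 1)" for x y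
    unfolding f0_def f3_def d0_def d3_def steps by (simp add: h_def w_def algebra_simps)
  have c20: "d1 y * f4 x (y + 1) + d2 x y * f2 (x + 1) y = f2 x y * d2 (x + 1) y + f4 x y * d1 (y - 1)" for x y
    unfolding f2_def f4_def d2_def key by (simp add: algebra_simps)
  have c2m: "d0 x y * f4 x y + d2 x y * f3 (x + 1) y + d3 x y * f2 (x + 1) (y - 1)
     = f2 x y * d3 (x + 1) y + f3 x y * d2 (x + 1) (y - 1) + f4 x y * d0 (x + 2) (y - 1)" for x y
    unfolding f2_def f3_def f4_def d0_def d2_def d3_def steps by (simp add: h_def w_def algebra_simps)
  have c2mm: "d3 x y * f3 (x + 1) (y - 1) = f3 x y * d3 (x + 1) (y - 1)" for x y
    unfolding f3_def d3_def steps by (simp add: algebra_simps)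
  have c3m: "d2 x y * f4 (x + 1) y = f4 x y * d2 (x + 2) (y - 1)" for x y
    unfolding f4_def d2_def by (simp add: algebra_simps)
  have c3mm: "d3 x y * f4 (x + 1) (y - 1) = f4 x y * d3 (x + 2) (y - 1)" for x y
    unfolding f4_def d3_def by (simp add: algebra_simps)
  have DF: "actD \<alpha> \<beta> k L (F a) m i = F (actD \<alpha> \<beta> k L a) m i"
  proof (cases i)
    case 0
    define x :: 'a where "x = of_nat m"
    have z: "d3 x 0 = 0" "f3 x 0 = 0" "f4 x 0 = 0" for x
      by (simp_all add: d3_def f3_def f4_def)
    have "actD \<alpha> \<beta> k L (F a) m i - F (actD \<alpha> \<beta> k L a) m i
      = (d0 x 0 * f1 x 0 + d1 0 * f0 x (0 + 1) - (f0 x 0 * d1 0 + f1 x 0 * d0 x (0 + 1))) * a m 1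
      + (d1 0 * f1 x (0 + 1) - f1 x 0 * d1 (0 + 1)) * a m 2
      + (d0 x 0 * f2 x 0 + d1 0 * f3 x (0 + 1) + d2 x 0 * f0 (x + 1) 0 + d3 x 0 * f1 (x + 1) (0 - 1)
         - (f0 x 0 * d2 x 0 + f1 x 0 * d3 x (0 + 1) + f2 x 0 * d0 (x + 1) 0 + f3 x 0 * d1 (0 - 1))) * a (m + 1) 0
      + (d1 0 * f2 x (0 + 1) + d2 x 0 * f1 (x + 1) 0 - (f1 x 0 * d2 x (0 + 1) + f2 x 0 * d1 0)) * a (m + 1) 1
      + (d1 0 * f4 x (0 + 1) + d2 x 0 * f2 (x + 1) 0 - (f2 x 0 * d2 (x + 1) 0 + f4 x 0 * d1 (0 - 1))) * a (m + 2) 0"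
      unfolding D F_def 0 by (simp add: z x_def numeral_2_eq_2 algebra_simps)
    then show ?thesis
      unfolding c01 c02 c10 c11 c20 by simp
  next
    case (Suc j)
    define x y :: 'a where "x = of_nat m" and "y = of_nat i"
    have j: "(of_nat j :: 'a) = y - 1" and m: "of_nat m = x" and i: "of_nat i = y"
      and i1: "of_nat (Suc i) = y + 1" and m1: "of_nat (Suc m) = x + 1"
      and m2: "of_nat (Suc (Suc m)) = x + 2"
      by (simp_all add: y_def x_def Suc)
    have idx: "Suc j = i" "i - 1 = j"
      using Suc by simp_all
    have "actD \<alpha> \<beta> k L (F a) m i - F (actD \<alpha> \<beta> k L a) m i
      = (d0 x y * f1 x y + d1 y * f0 x (y + 1) - (f0 x y * d1 y + f1 x y * d0 x (y + 1))) * a m (Suc i)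
      + (d1 y * f1 x (y + 1) - f1 x y * d1 (y + 1)) * a m (Suc (Suc i))
      + (d0 x y * f2 x y + d1 y * f3 x (y + 1) + d2 x y * f0 (x + 1) y + d3 x y * f1 (x + 1) (y - 1)
         - (f0 x y * d2 x y + f1 x y * d3 x (y + 1) + f2 x y * d0 (x + 1) y + f3 x y * d1 (y - 1))) * a (Suc m) i
      + (d1 y * f2 x (y + 1) + d2 x y * f1 (x + 1) y - (f1 x y * d2 x (y + 1) + f2 x y * d1 y)) * a (Suc m) (Suc i)
      + (d0 x y * f3 x y + d3 x y * f0 (x + 1) (y - 1) - (f0 x y * d3 x y + f3 x y * d0 (x + 1) (y - 1))) * a (Suc m) j
      + (d1 y * f4 x (y + 1) + d2 x y * f2 (x + 1) y - (f2 x y * d2 (x + 1) y + f4 x y * d1 (y - 1))) * a (Suc (Suc m)) i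
      + (d0 x y * f4 x y + d2 x y * f3 (x + 1) y + d3 x y * f2 (x + 1) (y - 1)
         - (f2 x y * d3 (x + 1) y + f3 x y * d2 (x + 1) (y - 1) + f4 x y * d0 (x + 2) (y - 1))) * a (Suc (Suc m)) j
      + (d3 x y * f3 (x + 1) (y - 1) - f3 x y * d3 (x + 1) (y - 1)) * a (Suc (Suc m)) (j - 1)
      + (d2 x y * f4 (x + 1) y - f4 x y * d2 (x + 2) (y - 1)) * a (Suc (Suc (Suc m))) j
      + (d3 x y * f4 (x + 1) (y - 1) - f4 x y * d3 (x + 2) (y - 1)) * a (Suc (Suc (Suc m))) (j - 1)"
      unfolding D F_def diff_Suc_1 idx j m i i1 m1 m2 by (simp only: ring_distribs, simp only: ac_simps idx, simp)
    then show ?thesis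
      unfolding c01 c02 c10 c11 c1m c20 c2m c2mm c3m c3mm by simp
  qed
  have "actD \<alpha> \<beta> k L (\<lambda>m i. c * u m i - 3 * v m i) m i
      = c * actD \<alpha> \<beta> k L u m i - 3 * actD \<alpha> \<beta> k L v m i" for u v
    by (simp add: D algebra_simps)
  from this[of "actD \<alpha> \<beta> k L a" "F a"] show ?thesis
    by (simp add: E[abs_def] DF)
qed

lemma diff_op_second_order:
  assumes "A \<in> carrier_mat n n" "B \<in> carrier_mat n n" "C \<in> carrier_mat n n"
    and "f \<in> carrier_vec n" and "i < n"
  shows "diff_op n [A, B, C] f $ i = (A *\<^sub>v f) $ i + (B *\<^sub>v map_vec pderiv f) $ i
    + (C *\<^sub>v map_vec pderiv (map_vec pderiv f)) $ i"
  using assms by (simp add: diff_op_Cons diff_op_Nil diff_op_closed del: index_mult_mat_vec)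

lemma smult_mat_mult_vec_nth:
  fixes p :: "complex poly"
  assumes "A \<in> carrier_mat n n" "f \<in> carrier_vec n" "i < n"
  shows "((p \<cdot>\<^sub>m A) *\<^sub>v f) $ i = p * (A *\<^sub>v f) $ i"
  using assms by (simp add: scalar_prod_smult_left carrier_vecD)

text \<open>
  No power of \<open>u\<close> exceeds the order of the derivative that it multiplies, so the coefficients at degree
  \<open>m\<close> involve only degrees at least \<open>m\<close> of the argument.
\<close>

lemma opD_coeff:
  assumes f: "f \<in> carrier_vec (l + 1)" and i: "i \<le> l"
  shows "coeff (opD l \<alpha> \<beta> k f $ i) m
    = actD (of_real \<alpha>) (of_real \<beta>) (of_real k) (of_nat l) (\<lambda>m i. coeff (f $ i) m) m i"
proof -
  let ?n = "l + 1"
  let ?f1 = "map_vec pderiv f" and ?f2 = "map_vec pderiv (map_vec pderiv f)"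
  have f1: "?f1 \<in> carrier_vec ?n" and f2: "?f2 \<in> carrier_vec ?n" and i': "i < ?n"
    using f i by simp_all
  have V: "matV l \<alpha> \<beta> k \<in> carrier_mat ?n ?n" and C: "matC l \<beta> \<in> carrier_mat ?n ?n"
    and U: "matU l \<alpha> \<beta> \<in> carrier_mat ?n ?n"
    by (simp_all add: matV_def matC_def matU_def const_mat_closed del: One_nat_def)
  have uU: "polU \<cdot>\<^sub>m matU l \<alpha> \<beta> \<in> carrier_mat ?n ?n"
    using U by simp
  have "opD l \<alpha> \<beta> k f $ i = (- matV l \<alpha> \<beta> k *\<^sub>v f) $ i
     + ((matC l \<beta> - polU \<cdot>\<^sub>m matU l \<alpha> \<beta>) *\<^sub>v ?f1) $ i
     + (((polU * (1 - polU)) \<cdot>\<^sub>m 1\<^sub>m ?n) *\<^sub>v ?f2) $ i"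
    unfolding opD_def by (rule diff_op_second_order) (use V C U f i' in auto)
  also have "(- matV l \<alpha> \<beta> k *\<^sub>v f) $ i = - ((matV l \<alpha> \<beta> k *\<^sub>v f) $ i)"
    using V f i by simp
  also have "((matC l \<beta> - polU \<cdot>\<^sub>m matU l \<alpha> \<beta>) *\<^sub>v ?f1) $ i
      = (matC l \<beta> *\<^sub>v ?f1) $ i - (polU \<cdot>\<^sub>m matU l \<alpha> \<beta> *\<^sub>v ?f1) $ i"
    using minus_mult_distrib_mat_vec[OF C uU f1] U i' by simp
  also have "(polU \<cdot>\<^sub>m matU l \<alpha> \<beta> *\<^sub>v ?f1) $ i = polU * (matU l \<alpha> \<beta> *\<^sub>v ?f1) $ i"
    by (rule smult_mat_mult_vec_nth[OF U f1 i'])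
  also have "(((polU * (1 - polU)) \<cdot>\<^sub>m 1\<^sub>m ?n) *\<^sub>v ?f2) $ i = polU * (1 - polU) * ?f2 $ i"
    by (subst smult_mat_mult_vec_nth[OF one_carrier_mat f2 i']) (simp only: one_mult_mat_vec[OF f2])
  finally have op: "opD l \<alpha> \<beta> k f $ i = - (matV l \<alpha> \<beta> k *\<^sub>v f) $ i
     + ((matC l \<beta> *\<^sub>v ?f1) $ i - polU * (matU l \<alpha> \<beta> *\<^sub>v ?f1) $ i)
     + polU * (1 - polU) * ?f2 $ i" .
  have pd: "?f1 $ j = pderiv (f $ j)" "?f2 $ j = pderiv (pderiv (f $ j))" if "j \<le> l" for j
    using that f by simp_all
  have il: "i - 1 \<le> l" using i by simp
  show ?thesis
    unfolding op matV_mult[OF f i] matC_mult[OF f1 i] matU_mult[OF f1 i] pd[OF i] pd[OF il]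
    by (cases m; cases "m - 1"; cases "i < l")
       (use i in \<open>auto simp: actD_def eigD_def coeff_pCons coeff_pderiv algebra_simps\<close>)
qed

lemma opE_coeff:
  assumes f: "f \<in> carrier_vec (l + 1)" and i: "i \<le> l"
  shows "coeff (opE l \<alpha> \<beta> k f $ i) m
    = actE (of_real \<alpha>) (of_real \<beta>) (of_real k) (of_nat l) (\<lambda>m i. coeff (f $ i) m) m i"
proof -
  let ?n = "l + 1" and ?c = "[:complex_of_real (\<alpha> + 2 * real l + 3 * k):]"
  let ?f1 = "map_vec pderiv f" and ?f2 = "map_vec pderiv (map_vec pderiv f)"
  have f1: "?f1 \<in> carrier_vec ?n" and f2: "?f2 \<in> carrier_vec ?n" and i': "i < ?n"
    using f i by simp_all
  have V: "matV l \<alpha> \<beta> k \<in> carrier_mat ?n ?n" and P0: "matP0 l \<alpha> \<beta> k \<in> carrier_mat ?n ?n"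
    and P1: "matP1 l \<alpha> \<beta> k \<in> carrier_mat ?n ?n"
    and Q0: "matQ0 l \<in> carrier_mat ?n ?n" and Q1: "matQ1 l \<alpha> \<in> carrier_mat ?n ?n"
    by (simp_all add: matV_def matP0_def matP1_def matQ0_def matQ1_def const_mat_closed del: One_nat_def)
  have uP: "polU \<cdot>\<^sub>m matP1 l \<alpha> \<beta> k \<in> carrier_mat ?n ?n" and uQ: "polU \<cdot>\<^sub>m matQ1 l \<alpha> \<in> carrier_mat ?n ?n"
    and cV: "?c \<cdot>\<^sub>m matV l \<alpha> \<beta> k \<in> carrier_mat ?n ?n"
    and Q: "matQ0 l + polU \<cdot>\<^sub>m matQ1 l \<alpha> \<in> carrier_mat ?n ?n"
    using P1 V Q0 Q1 by auto
  have "opE l \<alpha> \<beta> k f $ i = (- (?c \<cdot>\<^sub>m matV l \<alpha> \<beta> k) *\<^sub>v f) $ i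
     + ((matP0 l \<alpha> \<beta> k + polU \<cdot>\<^sub>m matP1 l \<alpha> \<beta> k) *\<^sub>v ?f1) $ i
     + (((1 - polU) \<cdot>\<^sub>m (matQ0 l + polU \<cdot>\<^sub>m matQ1 l \<alpha>)) *\<^sub>v ?f2) $ i"
    unfolding opE_def by (rule diff_op_second_order) (use cV P0 uP Q f i' in auto)
  also have "(- (?c \<cdot>\<^sub>m matV l \<alpha> \<beta> k) *\<^sub>v f) $ i = - ((?c \<cdot>\<^sub>m matV l \<alpha> \<beta> k *\<^sub>v f) $ i)"
    using V f i by simp
  also have "(?c \<cdot>\<^sub>m matV l \<alpha> \<beta> k *\<^sub>v f) $ i = ?c * (matV l \<alpha> \<beta> k *\<^sub>v f) $ i"
    by (rule smult_mat_mult_vec_nth[OF V f i'])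
  also have "((matP0 l \<alpha> \<beta> k + polU \<cdot>\<^sub>m matP1 l \<alpha> \<beta> k) *\<^sub>v ?f1) $ i
      = (matP0 l \<alpha> \<beta> k *\<^sub>v ?f1) $ i + (polU \<cdot>\<^sub>m matP1 l \<alpha> \<beta> k *\<^sub>v ?f1) $ i"
    using add_mult_distrib_mat_vec[OF P0 uP f1] P1 i' by simp
  also have "(polU \<cdot>\<^sub>m matP1 l \<alpha> \<beta> k *\<^sub>v ?f1) $ i = polU * (matP1 l \<alpha> \<beta> k *\<^sub>v ?f1) $ i"
    by (rule smult_mat_mult_vec_nth[OF P1 f1 i'])
  also have "(((1 - polU) \<cdot>\<^sub>m (matQ0 l + polU \<cdot>\<^sub>m matQ1 l \<alpha>)) *\<^sub>v ?f2) $ i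
      = (1 - polU) * ((matQ0 l + polU \<cdot>\<^sub>m matQ1 l \<alpha>) *\<^sub>v ?f2) $ i"
    by (rule smult_mat_mult_vec_nth[OF Q f2 i'])
  also have "((matQ0 l + polU \<cdot>\<^sub>m matQ1 l \<alpha>) *\<^sub>v ?f2) $ i
      = (matQ0 l *\<^sub>v ?f2) $ i + (polU \<cdot>\<^sub>m matQ1 l \<alpha> *\<^sub>v ?f2) $ i"
    using add_mult_distrib_mat_vec[OF Q0 uQ f2] Q1 i' by simp
  also have "(polU \<cdot>\<^sub>m matQ1 l \<alpha> *\<^sub>v ?f2) $ i = polU * (matQ1 l \<alpha> *\<^sub>v ?f2) $ i"
    by (rule smult_mat_mult_vec_nth[OF Q1 f2 i'])
  finally have op: "opE l \<alpha> \<beta> k f $ i = - (?c * (matV l \<alpha> \<beta> k *\<^sub>v f) $ i)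
     + ((matP0 l \<alpha> \<beta> k *\<^sub>v ?f1) $ i + polU * (matP1 l \<alpha> \<beta> k *\<^sub>v ?f1) $ i)
     + (1 - polU) * ((matQ0 l *\<^sub>v ?f2) $ i + polU * (matQ1 l \<alpha> *\<^sub>v ?f2) $ i)" .
  have pd: "?f1 $ j = pderiv (f $ j)" "?f2 $ j = pderiv (pderiv (f $ j))" if "j \<le> l" for j
    using that f by simp_all
  have il: "i - 1 \<le> l" using i by simp
  show ?thesis
    unfolding op matV_mult[OF f i] matP0_mult[OF f1 i] matP1_mult[OF f1 i]
      matQ0_mult[OF f2 i] matQ1_mult[OF f2 i] pd[OF i] pd[OF il]
    by (cases m; cases "m - 1"; cases "i < l")
       (use i f in \<open>auto simp: actE_def eigD_def slope_def shift_def coeff_pCons coeff_pderiv algebra_simps\<close>)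
qed

section \<open>Coordinates and triangular operators\<close>

lemma diff_op_smult:
  assumes "f \<in> carrier_vec n" "set As \<subseteq> carrier_mat n n"
  shows "diff_op n As ([:c:] \<cdot>\<^sub>v f) = [:c:] \<cdot>\<^sub>v diff_op n As f"
  using assms
proof (induction As arbitrary: f)
  case Nil
  then show ?case by (auto simp: diff_op_Nil intro!: eq_vecI)
next
  case (Cons A As)
  have A: "A \<in> carrier_mat n n" using Cons.prems by simp
  have "map_vec pderiv ([:c:] \<cdot>\<^sub>v f) = [:c:] \<cdot>\<^sub>v map_vec pderiv f"
    using Cons.prems by (intro eq_vecI) (auto simp: pderiv_smult)
  moreover have "A *\<^sub>v ([:c:] \<cdot>\<^sub>v f) = [:c:] \<cdot>\<^sub>v (A *\<^sub>v f)"
    using A Cons.prems by (intro eq_vecI) (auto simp: carrier_vecD)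
  moreover have "A *\<^sub>v f \<in> carrier_vec n"
    using A Cons.prems by auto
  moreover note cl = map_pderiv_closed[OF Cons.prems(1)]
  ultimately show ?case
    using Cons.prems Cons.IH[OF cl] diff_op_closed[OF cl, of As]
    by (simp add: diff_op_Cons smult_add_distrib_vec[of _ n])
qed

lemma diff_op_mem_smult:
  assumes "F \<in> carrier (diff_op_ring n)" "f \<in> carrier_vec n"
  shows "F ([:c:] \<cdot>\<^sub>v f) = [:c:] \<cdot>\<^sub>v F f"
  using assms by (auto simp: diff_op_ring_def diff_op_smult)

text \<open>
  The basis vector \<open>u\<^sup>m e\<^sub>i\<close> gets the number \<open>m * n + i\<close>, which is the lexicographic order: every
  vector is the finitely supported sequence of its coordinates.
\<close>

definition coord :: "nat \<Rightarrow> complex poly vec \<Rightarrow> nat \<Rightarrow> complex" where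
  "coord n f N = coeff (f $ (N mod n)) (N div n)"

lemma coord_add:
  assumes "0 < n" "f \<in> carrier_vec n" "g \<in> carrier_vec n"
  shows "coord n (f + g) N = coord n f N + coord n g N"
  using assms by (auto simp: coord_def)

lemma coord_smult:
  assumes "0 < n" "f \<in> carrier_vec n"
  shows "coord n ([:c:] \<cdot>\<^sub>v f) N = c * coord n f N"
  using assms by (auto simp: coord_def)

lemma coord_zero: "0 < n \<Longrightarrow> coord n (0\<^sub>v n) N = 0"
  by (simp add: coord_def)

lemma coord_index: "i < n \<Longrightarrow> coord n f (m * n + i) = coeff (f $ i) m"
  by (simp add: coord_def)

lemma coord_eqI:
  assumes "f \<in> carrier_vec n" "g \<in> carrier_vec n" "\<And>N. coord n f N = coord n g N"
  shows "f = g"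
proof (rule eq_vecI)
  fix i assume "i < dim_vec g"
  then have "i < n" using assms by auto
  then have "coeff (f $ i) m = coeff (g $ i) m" for m
    using assms(3)[of "m * n + i"] by (simp add: coord_index)
  then show "f $ i = g $ i" by (intro poly_eqI)
qed (use assms in auto)

lemma coord_eventually_zero:
  assumes "f \<in> carrier_vec n" "0 < n"
  shows "\<exists>B. \<forall>N\<ge>B. coord n f N = 0"
proof -
  define b where "b = Max ((\<lambda>i. degree (f $ i)) ` {..<n})"
  have "coord n f N = 0" if "N \<ge> Suc b * n" for N
  proof -
    have "Suc b \<le> N div n"
      using that assms(2) by (simp add: less_eq_div_iff_mult_less_eq)
    moreover have "degree (f $ (N mod n)) \<le> b"
      unfolding b_def using assms(2) by (intro Max_ge) auto
    ultimately show ?thesis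
      unfolding coord_def by (intro coeff_eq_0) simp
  qed
  then show ?thesis by blast
qed

definition unit_coord :: "nat \<Rightarrow> nat \<Rightarrow> complex poly vec" where
  "unit_coord n N = vec n (\<lambda>i. if i = N mod n then monom 1 (N div n) else 0)"

lemma coord_unit_coord:
  assumes "0 < n"
  shows "coord n (unit_coord n N) M = of_bool (M = N)"
proof -
  have "M = N \<longleftrightarrow> M mod n = N mod n \<and> M div n = N div n"
    by (metis div_mult_mod_eq)
  then show ?thesis
    using assms by (auto simp: coord_def unit_coord_def coeff_monom)
qed

text \<open>
  \<open>F\<close> respects the flag of the subspaces spanned by initial segments of the basis and acts on the
  successive one dimensional quotients by the scalars \<open>d N\<close>.
\<close>

definition triangular ::
  "nat \<Rightarrow> (complex poly vec \<Rightarrow> complex poly vec) \<Rightarrow> (nat \<Rightarrow> complex) \<Rightarrow> bool" where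
  "triangular n F d \<longleftrightarrow> (\<forall>f\<in>carrier_vec n. \<forall>N. (\<forall>M>N. coord n f M = 0) \<longrightarrow>
     (\<forall>M>N. coord n (F f) M = 0) \<and> coord n (F f) N = d N * coord n f N)"

lemma triangularD:
  assumes "triangular n F d" "f \<in> carrier_vec n" "\<And>M. M > N \<Longrightarrow> coord n f M = 0"
  shows "M > N \<Longrightarrow> coord n (F f) M = 0" "coord n (F f) N = d N * coord n f N"
  using assms unfolding triangular_def by blast+

lemma triangular_zero: "0 < n \<Longrightarrow> triangular n \<zero>\<^bsub>diff_op_ring n\<^esub> (\<lambda>N. 0)"
  by (simp add: triangular_def diff_op_ring_zero coord_zero)

lemma triangular_scalar_op: "0 < n \<Longrightarrow> triangular n (scalar_op n c) (\<lambda>N. c)"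
  by (simp add: triangular_def scalar_op_def coord_smult)

lemma triangular_add:
  assumes "0 < n" "triangular n F d" "triangular n G e"
    and F: "F \<in> carrier (diff_op_ring n)" and G: "G \<in> carrier (diff_op_ring n)"
  shows "triangular n (F \<oplus>\<^bsub>diff_op_ring n\<^esub> G) (\<lambda>N. d N + e N)"
  unfolding triangular_def
proof (intro ballI allI impI)
  fix f :: "complex poly vec" and N assume f: "f \<in> carrier_vec n" and z: "\<forall>M>N. coord n f M = 0"
  show "(\<forall>M>N. coord n ((F \<oplus>\<^bsub>diff_op_ring n\<^esub> G) f) M = 0)
      \<and> coord n ((F \<oplus>\<^bsub>diff_op_ring n\<^esub> G) f) N = (d N + e N) * coord n f N"
    using triangularD[OF assms(2) f, of N] triangularD[OF assms(3) f, of N] z assms(1) f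
      diff_op_mem_closed[OF F f] diff_op_mem_closed[OF G f]
    by (simp add: diff_op_ring_add coord_add algebra_simps)
qed

lemma triangular_mult:
  assumes "triangular n F d" "triangular n G e"
    and G: "G \<in> carrier (diff_op_ring n)"
  shows "triangular n (F \<otimes>\<^bsub>diff_op_ring n\<^esub> G) (\<lambda>N. d N * e N)"
  unfolding triangular_def
proof (intro ballI allI impI)
  fix f :: "complex poly vec" and N assume f: "f \<in> carrier_vec n" and z: "\<forall>M>N. coord n f M = 0"
  note g = triangularD[OF assms(2) f, of N]
  show "(\<forall>M>N. coord n ((F \<otimes>\<^bsub>diff_op_ring n\<^esub> G) f) M = 0)
      \<and> coord n ((F \<otimes>\<^bsub>diff_op_ring n\<^esub> G) f) N = (d N * e N) * coord n f N"
    using triangularD[OF assms(1) diff_op_mem_closed[OF G f], of N] g z f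
    by (simp add: diff_op_ring_mult)
qed

text \<open>
  By induction on \<open>N\<close>, \<open>S\<close> kills the span of the first \<open>N\<close> basis vectors. If \<open>f\<close> has top coordinate
  \<open>N\<close>, then \<open>A f - d N f\<close> is in the span of the earlier ones, so \<open>S\<close> kills it, and by commutation
  \<open>A (S f) = d N (S f)\<close>. The top coordinate \<open>K\<close> of a nonzero \<open>S f\<close> would be below \<open>N\<close>, yet \<open>d K = d N\<close>.
\<close>

lemma triangular_commuting_zero:
  assumes n: "0 < n"
    and A: "A \<in> carrier (diff_op_ring n)" "triangular n A d" "inj d"
    and S: "S \<in> carrier (diff_op_ring n)" "triangular n S (\<lambda>N. 0)"
    and comm: "A \<otimes>\<^bsub>diff_op_ring n\<^esub> S = S \<otimes>\<^bsub>diff_op_ring n\<^esub> A"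
  shows "S = \<zero>\<^bsub>diff_op_ring n\<^esub>"
proof -
  have zero_iff: "f = 0\<^sub>v n" if "f \<in> carrier_vec n" "\<And>N. coord n f N = 0" for f
    using that n by (intro coord_eqI[of f n]) (auto simp: coord_zero)
  have S0: "S f = 0\<^sub>v n" if f: "f \<in> carrier_vec n" and z: "\<And>M. N \<le> M \<Longrightarrow> coord n f M = 0" for N f
    using f z
  proof (induction N arbitrary: f)
    case 0
    have "coord n (S f) M = 0" for M
      using triangularD[OF S(2) 0(1), of 0] 0(2) by (cases M) auto
    then show ?case by (intro zero_iff diff_op_mem_closed[OF S(1) 0(1)])
  next
    case (Suc N)
    note f = Suc.prems(1)
    have Sf: "S f \<in> carrier_vec n" and Af: "A f \<in> carrier_vec n"
      using diff_op_mem_closed S(1) A(1) f by blast+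
    have Af_coord: "coord n (A f) M = 0" if "M > N" for M
      using triangularD(1)[OF A(2) f, of N] Suc.prems(2) that by simp
    define g where "g = A f + [:- d N:] \<cdot>\<^sub>v f"
    have g: "g \<in> carrier_vec n" using Af f by (simp add: g_def)
    have "coord n g M = 0" if "N \<le> M" for M
    proof (cases "M = N")
      case True
      then show ?thesis
        using triangularD(2)[OF A(2) f, of N] Suc.prems(2) n f Af
        by (simp add: g_def coord_add coord_smult Suc_le_eq)
    next
      case False
      then show ?thesis
        using Af_coord[of M] Suc.prems(2)[of M] that n f Af
        by (simp add: g_def coord_add coord_smult Suc_le_eq)
    qed
    then have "S g = 0\<^sub>v n" by (rule Suc.IH[OF g])
    moreover have "S g = A (S f) + [:- d N:] \<cdot>\<^sub>v S f"
    proof -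
      have "A (S f) = S (A f)"
        using fun_cong[OF comm, of f] f by (simp add: diff_op_ring_mult)
      then show ?thesis
        using diff_op_mem_add[OF S(1) Af, of "[:- d N:] \<cdot>\<^sub>v f"] diff_op_mem_smult[OF S(1) f] f
        by (simp add: g_def)
    qed
    ultimately have eig: "A (S f) + [:- d N:] \<cdot>\<^sub>v S f = 0\<^sub>v n" by simp
    have low: "coord n (S f) M = 0" if "N \<le> M" for M
      using triangularD[OF S(2) f, of N] Suc.prems(2) that by (cases "M = N") auto
    show ?case
    proof (rule ccontr)
      assume "S f \<noteq> 0\<^sub>v n"
      then obtain K0 where K0: "coord n (S f) K0 \<noteq> 0" using zero_iff[OF Sf] by blast
      define K where "K = (GREATEST K. coord n (S f) K \<noteq> 0)"
      have bd: "\<forall>M. coord n (S f) M \<noteq> 0 \<longrightarrow> M \<le> N" using low by (meson nat_le_linear)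
      have K: "coord n (S f) K \<noteq> 0"
        unfolding K_def using GreatestI_nat[of "\<lambda>K. coord n (S f) K \<noteq> 0", OF K0] bd by blast
      have above: "coord n (S f) M = 0" if "M > K" for M
        using Greatest_le_nat[of "\<lambda>K. coord n (S f) K \<noteq> 0" M N] bd that unfolding K_def by fastforce
      have "d K * coord n (S f) K + (- d N) * coord n (S f) K = coord n (0\<^sub>v n) K"
        unfolding eig[symmetric] using n Sf diff_op_mem_closed[OF A(1) Sf]
        by (simp add: coord_add coord_smult triangularD(2)[OF A(2) Sf above])
      then have "(d K - d N) * coord n (S f) K = 0" using n by (simp add: coord_zero algebra_simps)
      then have "K = N" using K A(3) by (simp add: inj_eq)
      then show False using K low by simp
    qed
  qed
  have "S f = 0\<^sub>v n" if f: "f \<in> carrier_vec n" for f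
    using coord_eventually_zero[OF f n] S0[OF f] by blast
  then have "(\<lambda>f\<in>carrier_vec n. S f) = (\<lambda>f\<in>carrier_vec n. 0\<^sub>v n)"
    by (intro restrict_ext) simp
  then show ?thesis
    by (simp only: diff_op_mem_ext[OF S(1)] diff_op_ring_zero)
qed

section \<open>Evaluation at two commuting operators\<close>

locale commuting_operators =
  fixes n :: nat and A B :: "complex poly vec \<Rightarrow> complex poly vec"
  assumes dim_pos: "0 < n"
    and A_closed: "A \<in> carrier (diff_op_ring n)"
    and B_closed: "B \<in> carrier (diff_op_ring n)"
    and AB_commute: "A \<otimes>\<^bsub>diff_op_ring n\<^esub> B = B \<otimes>\<^bsub>diff_op_ring n\<^esub> A"
begin

lemma scalar_op_commute:
  assumes "F \<in> carrier (diff_op_ring n)"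
  shows "scalar_op n c \<otimes>\<^bsub>diff_op_ring n\<^esub> F = F \<otimes>\<^bsub>diff_op_ring n\<^esub> scalar_op n c"
  using assms
  by (auto simp: diff_op_ring_mult scalar_op_def diff_op_mem_closed diff_op_mem_smult intro!: restrict_ext)

sublocale inner: poly_subst "diff_op_ring n" "scalar_op n" A
proof (intro poly_subst.intro poly_subst_axioms.intro ring_diff_op_ring)
  fix a b :: complex
  show "scalar_op n (a + b) = scalar_op n a \<oplus>\<^bsub>diff_op_ring n\<^esub> scalar_op n b"
    by (auto simp: scalar_op_def diff_op_ring_add smult_add_left intro!: restrict_ext eq_vecI)
  show "scalar_op n (a * b) = scalar_op n a \<otimes>\<^bsub>diff_op_ring n\<^esub> scalar_op n b"
    by (auto simp: scalar_op_def diff_op_ring_mult mult.commute intro!: restrict_ext eq_vecI)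
  show "scalar_op n 1 = \<one>\<^bsub>diff_op_ring n\<^esub>"
    by (auto simp: scalar_op_def diff_op_ring_one intro!: restrict_ext eq_vecI)
qed (simp_all add: scalar_op_carrier A_closed scalar_op_commute)

sublocale outer: poly_subst "diff_op_ring n" inner.subst B
proof (intro poly_subst.intro poly_subst_axioms.intro ring_diff_op_ring)
  show "inner.subst 1 = \<one>\<^bsub>diff_op_ring n\<^esub>"
    using inner.subst_const[of 1] by (simp add: inner.c_one one_pCons)
  show "inner.subst p \<otimes>\<^bsub>diff_op_ring n\<^esub> B = B \<otimes>\<^bsub>diff_op_ring n\<^esub> inner.subst p" for p
    by (rule inner.subst_commute) (simp_all add: B_closed scalar_op_commute AB_commute)
qed (simp_all add: inner.subst_closed inner.subst_add inner.subst_mult B_closed)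

abbreviation ev :: "complex poly poly \<Rightarrow> complex poly vec \<Rightarrow> complex poly vec" where
  "ev \<equiv> outer.subst"

lemma ev_const: "ev (const_xy c) = scalar_op n c"
  by (simp add: const_xy_def outer.subst_const inner.subst_const)

lemma ev_x: "ev var_x = A"
  by (simp add: var_x_def outer.subst_const inner.subst_var)

lemma ev_y: "ev var_y = B"
  by (simp add: var_y_def outer.subst_var)

lemma ev_one: "ev 1 = \<one>\<^bsub>diff_op_ring n\<^esub>"
  using outer.subst_const[of 1] by (simp only: outer.c_one pCons_one)

lemma ev_commute: "ev p \<otimes>\<^bsub>diff_op_ring n\<^esub> ev q = ev q \<otimes>\<^bsub>diff_op_ring n\<^esub> ev p"
  by (simp add: outer.subst_mult[symmetric] mult.commute)

lemma ring_hom_ev: "ev \<in> ring_hom poly_xy_ring (diff_op_ring n)"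
  by (intro ring_hom_memI)
     (simp_all add: poly_xy_ring_def outer.subst_closed outer.subst_mult outer.subst_add ev_one)

lemma carrier_generated_algebra: "carrier (generated_algebra n {A, B}) = range ev"
proof
  let ?R = "diff_op_ring n" and ?H = "range (scalar_op n) \<union> {A, B}"
  interpret ring_hom_ring poly_xy_ring ?R ev
    using ring_hom_ringI2[OF cring.axioms(1)[OF cring_poly_xy_ring] ring_diff_op_ring ring_hom_ev] .
  have H: "?H \<subseteq> carrier ?R"
    using A_closed B_closed scalar_op_carrier by auto
  have "subring (ev ` carrier poly_xy_ring) ?R"
    by (rule img_is_subring) (rule R.carrier_is_subring)
  then have "generate_ring ?R ?H \<subseteq> range ev"
  proof (intro inner.generate_ring_min_subring1[OF H])
    show "?H \<subseteq> range ev"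
      using ev_const ev_x ev_y by (auto simp: image_iff) metis+
  qed (simp add: poly_xy_ring_def)
  then show "carrier (generated_algebra n {A, B}) \<subseteq> range ev"
    by (simp add: generated_algebra_def)
  have gen: "subring (generate_ring ?R ?H) ?R"
    by (rule inner.generate_ring_is_subring[OF H])
  have "A \<in> generate_ring ?R ?H" "B \<in> generate_ring ?R ?H" "range (scalar_op n) \<subseteq> generate_ring ?R ?H"
    by (auto intro: generate_ring.incl)
  then have "ev p \<in> generate_ring ?R ?H" for p
    using inner.subst_in_subring[OF gen] outer.subst_in_subring[OF gen] by blast
  then show "range ev \<subseteq> carrier (generated_algebra n {A, B})"
    by (auto simp: generated_algebra_def)
qed

lemma triangular_ev:
  assumes A: "triangular n A d" and B: "triangular n B e"
  shows "triangular n (ev p) (\<lambda>N. poly (poly p [:e N:]) (d N))"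
proof -
  have inner: "triangular n (inner.subst q) (\<lambda>N. poly q (d N))" for q
  proof (induction q)
    case 0
    show ?case using triangular_zero[OF dim_pos] by (simp add: inner.subst_0)
  next
    case (pCons a q)
    show ?case
      using triangular_add[OF dim_pos triangular_scalar_op[OF dim_pos, of a]
          triangular_mult[OF A pCons(2) inner.subst_closed]]
      by (simp add: inner.subst_pCons scalar_op_carrier inner.subst_closed A_closed)
  qed
  show ?thesis
  proof (induction p)
    case 0
    show ?case using triangular_zero[OF dim_pos] by (simp add: outer.subst_0)
  next
    case (pCons a p)
    show ?case
      using triangular_add[OF dim_pos inner[of a] triangular_mult[OF B pCons(2) outer.subst_closed]]
      by (simp add: outer.subst_pCons inner.subst_closed outer.subst_closed B_closed)
  qed
qed

lemma ev_eq_zeroI: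
  assumes "triangular n A d" "triangular n B e" "inj d"
    and "\<And>N. poly (poly p [:e N:]) (d N) = 0"
  shows "ev p = \<zero>\<^bsub>diff_op_ring n\<^esub>"
proof (rule triangular_commuting_zero[OF dim_pos A_closed assms(1,3) outer.subst_closed])
  show "triangular n (ev p) (\<lambda>N. 0)"
    using triangular_ev[OF assms(1,2), of p] assms(4) by simp
  show "A \<otimes>\<^bsub>diff_op_ring n\<^esub> ev p = ev p \<otimes>\<^bsub>diff_op_ring n\<^esub> A"
    using ev_commute[of var_x p] by (simp add: ev_x)
qed

text \<open>
  Apply \<open>p(A, B)\<close> to the \<open>N\<close>-th basis vector and read off the \<open>N\<close>-th coordinate.
\<close>

lemma ev_eq_zeroD:
  assumes "triangular n A d" "triangular n B e" and "ev p = \<zero>\<^bsub>diff_op_ring n\<^esub>"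
  shows "poly (poly p [:e N:]) (d N) = 0"
proof -
  have u: "unit_coord n N \<in> carrier_vec n" by (simp add: unit_coord_def)
  show ?thesis
    using triangularD(2)[OF triangular_ev[OF assms(1,2), of p] u, of N] dim_pos u
    by (simp add: coord_unit_coord assms(3) diff_op_ring_zero coord_zero)
qed

text \<open>
  The first isomorphism theorem gives an isomorphism from the quotient to the generated algebra; the
  one wanted is its inverse. Both respect the structure maps since \<open>ev\<close> sends constants to scalars.
\<close>

lemma isomorphic_quotient:
  assumes ker: "\<And>p. ev p = \<zero>\<^bsub>diff_op_ring n\<^esub> \<longleftrightarrow> q dvd p"
  shows "complex_alg_isomorphic (generated_algebra n {A, B}) (scalar_op n)
           (quotient_xy q) (quotient_xy_scalar q)"
proof -
  let ?R = "diff_op_ring n" and ?P = poly_xy_ring and ?G = "generated_algebra n {A, B}"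
  interpret P: cring ?P by (rule cring_poly_xy_ring)
  have H: "range (scalar_op n) \<union> {A, B} \<subseteq> carrier ?R"
    using A_closed B_closed scalar_op_carrier by auto
  have G: "ring ?G"
    unfolding generated_algebra_def by (rule inner.generate_ring_is_ring[OF H])
  have "ev \<in> ring_hom ?P ?G"
    using ring_hom_ev carrier_generated_algebra
    by (auto simp: ring_hom_def generated_algebra_def)
  then interpret h: ring_hom_ring ?P ?G ev
    by (intro ring_hom_ringI2 P.ring_axioms G)
  have carrP: "carrier ?P = UNIV"
    by (simp add: poly_xy_ring_def)
  have zero: "\<zero>\<^bsub>?G\<^esub> = \<zero>\<^bsub>?R\<^esub>"
    by (simp add: generated_algebra_def)
  have "a_kernel ?P ?G ev = {p. q dvd p}"
    unfolding a_kernel_def' zero ker by (simp add: poly_xy_ring_def)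
  also have "\<dots> = PIdl\<^bsub>?P\<^esub> q"
    unfolding cgenideal_def poly_xy_ring_def by (auto elim!: dvdE simp: mult.commute[of q])
  also have "\<dots> = Idl\<^bsub>?P\<^esub> {q}"
    by (rule P.cgenideal_eq_genideal) (simp add: poly_xy_ring_def)
  finally have K: "a_kernel ?P ?G ev = Idl\<^bsub>?P\<^esub> {q}" .
  define \<psi> where "\<psi> = (\<lambda>X. the_elem (ev ` X))"
  have iso: "\<psi> \<in> ring_iso (quotient_xy q) ?G"
    using h.FactRing_iso_set carrier_generated_algebra
    by (simp add: K quotient_xy_def \<psi>_def carrP)
  have "ring (quotient_xy q)"
    unfolding quotient_xy_def K[symmetric] by (rule ideal.quotient_is_ring[OF h.kernel_is_ideal])
  from ring_iso_set_sym[OF this iso]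
  have "inv_into (carrier (quotient_xy q)) \<psi> \<in> ring_iso ?G (quotient_xy q)" .
  moreover have "inv_into (carrier (quotient_xy q)) \<psi> (scalar_op n c) = quotient_xy_scalar q c" for c
  proof (rule inv_into_f_eq)
    show "inj_on \<psi> (carrier (quotient_xy q))"
      using iso by (simp add: ring_iso_def bij_betw_def)
    show "quotient_xy_scalar q c \<in> carrier (quotient_xy q)"
      by (auto simp: quotient_xy_scalar_def quotient_xy_def FactRing_def A_RCOSETS_def' poly_xy_ring_def)
    show "\<psi> (quotient_xy_scalar q c) = scalar_op n c"
      using h.the_elem_simp[of "const_xy c"]
      by (simp add: \<psi>_def quotient_xy_scalar_def K ev_const carrP)
  qed
  ultimately show ?thesis
    unfolding complex_alg_isomorphic_def by blast
qed

end

text \<open>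
  Evaluating at a point of the graph of \<open>q\<close> is the same as substituting \<open>q\<close> and then evaluating.
\<close>

lemma poly_poly_const: "poly (poly p [:poly q z:]) z = poly (poly p q) z"
  for z :: "'a::comm_ring_1"
  by (induction p) simp_all

lemma prod_linear_dvd:
  fixes p :: "'a::idom poly"
  assumes "finite J" "inj_on r J" "\<And>j. j \<in> J \<Longrightarrow> poly p (r j) = 0"
  shows "(\<Prod>j\<in>J. [:- r j, 1:]) dvd p"
  using assms
proof (induction J arbitrary: p rule: finite_induct)
  case (insert j J)
  then obtain s where s: "p = [:- r j, 1:] * s"
    using poly_eq_0_iff_dvd[of p "r j"] by (auto elim: dvdE)
  have "poly s (r i) = 0" if "i \<in> J" for i
  proof -
    have "r i \<noteq> r j" using insert that by (auto simp: inj_on_def)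
    moreover have "poly p (r i) = 0" using insert.prems that by simp
    ultimately show ?thesis by (simp add: s)
  qed
  then have "(\<Prod>j\<in>J. [:- r j, 1:]) dvd s"
    using insert.IH[of s] insert.prems(1) by simp
  then show ?case
    using insert.hyps s by (simp add: mult_dvd_mono del: mult_pCons_left)
qed simp

section \<open>The common triangular form of the two operators\<close>

text \<open>
  The coordinates arranged as an array, cut off outside the range of the components. The recurrences
  never see the cut, because the neighbours outside the range have coefficient 0.
\<close>

definition grid :: "nat \<Rightarrow> complex poly vec \<Rightarrow> nat \<Rightarrow> nat \<Rightarrow> complex" where
  "grid l f m i = (if i \<le> l then coord (l + 1) f (m * (l + 1) + i) else 0)"

lemma grid_coeff: "i \<le> l \<Longrightarrow> grid l f m i = coeff (f $ i) m"
  using coord_index[of i "l + 1" f m] by (simp only: grid_def if_True)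

lemma mod_le_dim: "N mod (l + 1) \<le> l" for N l :: nat
  using mod_less_divisor[of "l + 1" N] by simp

lemma coord_grid: "coord (l + 1) f N = grid l f (N div (l + 1)) (N mod (l + 1))"
  by (simp only: grid_def mod_le_dim if_True div_mult_mod_eq)

lemma index_div_mod:
  fixes i l m :: nat
  assumes "i \<le> l"
  shows "(m * (l + 1) + i) div (l + 1) = m" "(m * (l + 1) + i) mod (l + 1) = i"
proof -
  have "i < l + 1" using assms by simp
  then show "(m * (l + 1) + i) div (l + 1) = m" "(m * (l + 1) + i) mod (l + 1) = i"
    by (simp_all only: div_mult_self3 mod_mult_self3 div_less mod_less add_0_right)
qed

lemma actD_cong:
  assumes "\<And>m i. i \<le> l \<Longrightarrow> a m i = b m i" "i \<le> l"
  shows "actD \<alpha> \<beta> k (of_nat l) a m i = actD \<alpha> \<beta> k (of_nat l) b m i"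
  using assms by (cases "i = l") (auto simp: actD_def)

lemma actE_cong:
  assumes "\<And>m i. i \<le> l \<Longrightarrow> a m i = b m i" "i \<le> l"
  shows "actE \<alpha> \<beta> k (of_nat l) a m i = actE \<alpha> \<beta> k (of_nat l) b m i"
  using assms by (cases "i = l") (auto simp: actE_def)

lemma grid_opD:
  assumes "f \<in> carrier_vec (l + 1)" "i \<le> l"
  shows "grid l (opD l \<alpha> \<beta> k f) m i
    = actD (of_real \<alpha>) (of_real \<beta>) (of_real k) (of_nat l) (grid l f) m i"
  unfolding grid_coeff[OF assms(2)] opD_coeff[OF assms]
  by (intro actD_cong assms(2)) (simp add: grid_coeff)

lemma grid_opE:
  assumes "f \<in> carrier_vec (l + 1)" "i \<le> l"
  shows "grid l (opE l \<alpha> \<beta> k f) m i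
    = actE (of_real \<alpha>) (of_real \<beta>) (of_real k) (of_nat l) (grid l f) m i"
  unfolding grid_coeff[OF assms(2)] opE_coeff[OF assms]
  by (intro actE_cong assms(2)) (simp add: grid_coeff)

lemma commuting_operators_opD_opE: "commuting_operators (l + 1) (opD l \<alpha> \<beta> k) (opE l \<alpha> \<beta> k)"
proof
  let ?D = "opD l \<alpha> \<beta> k" and ?E = "opE l \<alpha> \<beta> k"
  have "?D (?E f) = ?E (?D f)" if f: "f \<in> carrier_vec (l + 1)" for f
  proof (rule coord_eqI)
    note Df = diff_op_mem_closed[OF opD_carrier f, of \<alpha> \<beta> k]
    note Ef = diff_op_mem_closed[OF opE_carrier f, of \<alpha> \<beta> k]
    show "?D (?E f) \<in> carrier_vec (l + 1)" "?E (?D f) \<in> carrier_vec (l + 1)"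
      using diff_op_mem_closed[OF opD_carrier Ef] diff_op_mem_closed[OF opE_carrier Df] by blast+
    fix N
    have i: "N mod (l + 1) \<le> l" by (rule mod_le_dim)
    let ?actD = "actD (of_real \<alpha>) (of_real \<beta>) (of_real k) (of_nat l) :: _ \<Rightarrow> _ \<Rightarrow> _ \<Rightarrow> complex"
      and ?actE = "actE (of_real \<alpha>) (of_real \<beta>) (of_real k) (of_nat l) :: _ \<Rightarrow> _ \<Rightarrow> _ \<Rightarrow> complex"
    have "grid l (?D (?E f)) m i = grid l (?E (?D f)) m i" if i: "i \<le> l" for m i
    proof -
      have "grid l (?D (?E f)) m i = ?actD (grid l (?E f)) m i" by (rule grid_opD[OF Ef i])
      also have "\<dots> = ?actD (?actE (grid l f)) m i" by (rule actD_cong[OF grid_opE[OF f] i])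
      also have "\<dots> = ?actE (?actD (grid l f)) m i" by (rule actD_actE_commute)
      also have "\<dots> = ?actE (grid l (?D f)) m i" by (rule actE_cong[OF grid_opD[OF f, symmetric] i])
      also have "\<dots> = grid l (?E (?D f)) m i" by (rule grid_opE[OF Df i, symmetric])
      finally show ?thesis .
    qed
    with i show "coord (l + 1) (?D (?E f)) N = coord (l + 1) (?E (?D f)) N"
      unfolding coord_grid by blast
  qed
  then show "?D \<otimes>\<^bsub>diff_op_ring (l + 1)\<^esub> ?E = ?E \<otimes>\<^bsub>diff_op_ring (l + 1)\<^esub> ?D"
    by (auto simp: diff_op_ring_mult intro!: restrict_ext simp del: One_nat_def)
qed (simp, rule opD_carrier, rule opE_carrier)

definition eigD_at :: "nat \<Rightarrow> real \<Rightarrow> real \<Rightarrow> real \<Rightarrow> nat \<Rightarrow> complex" where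
  "eigD_at l \<alpha> \<beta> k N = eigD (of_real \<alpha>) (of_real \<beta>) (of_real k) (of_nat l) (N div (l + 1)) (N mod (l + 1))"

text \<open>
  The \<open>j\<close>-th line of the curve \<open>Q = 0\<close>, as the graph of a polynomial in \<open>x\<close>.
\<close>

definition branch :: "nat \<Rightarrow> real \<Rightarrow> real \<Rightarrow> real \<Rightarrow> nat \<Rightarrow> complex poly" where
  "branch l \<alpha> \<beta> k j = [:- shift (of_real \<alpha>) (of_real \<beta>) (of_real k) (of_nat l) j, slope (of_real \<alpha>) (of_nat l) j:]"

text \<open>
  In terms of arrays, an operator is triangular as soon as every entry of the image depends only on the
  entries of the argument at lexicographically later or equal places.
\<close>

lemma triangularI_grid:
  assumes "\<And>f m i. \<lbrakk>f \<in> carrier_vec (l + 1); i \<le> l;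
      \<And>m' i'. m < m' \<or> m = m' \<and> i < i' \<Longrightarrow> grid l f m' i' = 0\<rbrakk>
      \<Longrightarrow> grid l (F f) m i = d (m * (l + 1) + i) * grid l f m i"
  shows "triangular (l + 1) F d"
  unfolding triangular_def
proof (intro ballI allI impI)
  fix f :: "complex poly vec" and N
  assume f: "f \<in> carrier_vec (l + 1)" and z: "\<forall>M>N. coord (l + 1) f M = 0"
  have above: "grid l f m' i' = 0" if "m < m' \<or> m = m' \<and> i < i'" "N \<le> m * (l + 1) + i" "i \<le> l" for m i m' i'
  proof (cases "i' \<le> l")
    case True
    have "m * (l + 1) + i < m' * (l + 1) + i'"
    proof (cases "m < m'")
      case True
      then have "(m + 1) * (l + 1) \<le> m' * (l + 1)" by (intro mult_le_mono1) simp
      then show ?thesis using that(3) by simp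
    qed (use that(1) in simp)
    then show ?thesis using z that(2) by (simp add: grid_def)
  qed (simp add: grid_def)
  have eq: "coord (l + 1) (F f) M = d M * coord (l + 1) f M" if "N \<le> M" for M
  proof -
    have i: "M mod (l + 1) \<le> l" by (rule mod_le_dim)
    have M: "M div (l + 1) * (l + 1) + M mod (l + 1) = M" by (rule div_mult_mod_eq)
    show ?thesis
      unfolding coord_grid using assms[OF f i above[OF _ _ i, of "M div (l + 1)"]] that M by simp
  qed
  show "(\<forall>M>N. coord (l + 1) (F f) M = 0) \<and> coord (l + 1) (F f) N = d N * coord (l + 1) f N"
    using eq z by simp
qed

lemma triangular_opD: "triangular (l + 1) (opD l \<alpha> \<beta> k) (eigD_at l \<alpha> \<beta> k)"
proof (rule triangularI_grid)
  fix f m i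
  assume f: "f \<in> carrier_vec (l + 1)" and i: "i \<le> l"
    and z: "\<And>m' i'. m < m' \<or> m = m' \<and> i < i' \<Longrightarrow> grid l f m' i' = 0"
  show "grid l (opD l \<alpha> \<beta> k f) m i = eigD_at l \<alpha> \<beta> k (m * (l + 1) + i) * grid l f m i"
    unfolding grid_opD[OF f i] eigD_at_def index_div_mod[OF i] by (simp add: actD_def z)
qed

lemma triangular_opE:
  "triangular (l + 1) (opE l \<alpha> \<beta> k)
     (\<lambda>N. poly (branch l \<alpha> \<beta> k (N mod (l + 1))) (eigD_at l \<alpha> \<beta> k N))"
proof (rule triangularI_grid)
  fix f m i
  assume f: "f \<in> carrier_vec (l + 1)" and i: "i \<le> l"
    and z: "\<And>m' i'. m < m' \<or> m = m' \<and> i < i' \<Longrightarrow> grid l f m' i' = 0"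
  show "grid l (opE l \<alpha> \<beta> k f) m i
      = poly (branch l \<alpha> \<beta> k ((m * (l + 1) + i) mod (l + 1))) (eigD_at l \<alpha> \<beta> k (m * (l + 1) + i)) * grid l f m i"
    unfolding grid_opE[OF f i] eigD_at_def index_div_mod[OF i] by (simp add: actE_def z branch_def algebra_simps)
qed

lemma polyQ_eq: "polyQ l \<alpha> \<beta> k = (\<Prod>j=0..l. [:- branch l \<alpha> \<beta> k j, 1:])"
  unfolding polyQ_def
  by (intro prod.cong refl)
     (simp add: var_x_def var_y_def const_xy_def branch_def slope_def shift_def algebra_simps)

lemma inj_branch: "inj (branch l \<alpha> \<beta> k)"
  by (rule injI) (simp add: branch_def slope_def)

lemma poly_polyQ_branch: "j \<le> l \<Longrightarrow> poly (polyQ l \<alpha> \<beta> k) (branch l \<alpha> \<beta> k j) = 0"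
  unfolding polyQ_eq poly_prod by (intro prod_zero bexI[of _ j]) simp_all

section \<open>The relation between the operators, for all parameters\<close>

text \<open>
  Vectors carry no topology here, so continuity is meant coordinate by coordinate. Letting the argument
  vary with the parameter makes the notion stable under composition.
\<close>

definition continuous_family ::
  "nat \<Rightarrow> (real \<Rightarrow> complex poly vec \<Rightarrow> complex poly vec) \<Rightarrow> bool" where
  "continuous_family n F \<longleftrightarrow> (\<forall>f. (\<forall>t. f t \<in> carrier_vec n) \<and> (\<forall>N. continuous_on UNIV (\<lambda>t. coord n (f t) N))
     \<longrightarrow> (\<forall>N. continuous_on UNIV (\<lambda>t. coord n (F t (f t)) N)))"

lemma continuous_familyI:
  assumes "\<And>f N. (\<And>t. f t \<in> carrier_vec n) \<Longrightarrow> (\<And>N. continuous_on UNIV (\<lambda>t. coord n (f t) N))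
     \<Longrightarrow> continuous_on UNIV (\<lambda>t. coord n (F t (f t)) N)"
  shows "continuous_family n F"
  using assms unfolding continuous_family_def by blast

lemma continuous_familyD:
  assumes "continuous_family n F" "\<And>t. f t \<in> carrier_vec n" "\<And>N. continuous_on UNIV (\<lambda>t. coord n (f t) N)"
  shows "continuous_on UNIV (\<lambda>t. coord n (F t (f t)) N)"
  using assms unfolding continuous_family_def by blast

lemma continuous_family_mult:
  assumes F: "continuous_family n F" and G: "continuous_family n G"
    and cl: "\<And>t. G t \<in> carrier (diff_op_ring n)"
  shows "continuous_family n (\<lambda>t. F t \<otimes>\<^bsub>diff_op_ring n\<^esub> G t)"
proof (rule continuous_familyI)
  fix f :: "real \<Rightarrow> complex poly vec" and N assume f: "\<And>t. f t \<in> carrier_vec n" and c: "\<And>N. continuous_on UNIV (\<lambda>t. coord n (f t) N)"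
  show "continuous_on UNIV (\<lambda>t. coord n ((F t \<otimes>\<^bsub>diff_op_ring n\<^esub> G t) (f t)) N)"
    using continuous_familyD[OF F, of "\<lambda>t. G t (f t)"] continuous_familyD[OF G, of f] f c
      diff_op_mem_closed[OF cl f]
    by (simp add: diff_op_ring_mult)
qed

lemma continuous_family_add:
  assumes n: "0 < n" and F: "continuous_family n F" and G: "continuous_family n G"
    and cl: "\<And>t. F t \<in> carrier (diff_op_ring n)" "\<And>t. G t \<in> carrier (diff_op_ring n)"
  shows "continuous_family n (\<lambda>t. F t \<oplus>\<^bsub>diff_op_ring n\<^esub> G t)"
proof (rule continuous_familyI)
  fix f :: "real \<Rightarrow> complex poly vec" and N assume f: "\<And>t. f t \<in> carrier_vec n" and c: "\<And>N. continuous_on UNIV (\<lambda>t. coord n (f t) N)"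
  show "continuous_on UNIV (\<lambda>t. coord n ((F t \<oplus>\<^bsub>diff_op_ring n\<^esub> G t) (f t)) N)"
    using continuous_familyD[OF F, of f] continuous_familyD[OF G, of f] f c n
      diff_op_mem_closed[OF cl(1) f] diff_op_mem_closed[OF cl(2) f]
    by (simp add: diff_op_ring_add coord_add continuous_on_add)
qed

lemma continuous_family_scalar_op:
  assumes "0 < n" "continuous_on UNIV c"
  shows "continuous_family n (\<lambda>t. scalar_op n (c t))"
  by (rule continuous_familyI)
     (use assms in \<open>simp add: scalar_op_def coord_smult continuous_on_mult\<close>)

lemma continuous_grid:
  assumes "\<And>N. continuous_on UNIV (\<lambda>t::real. coord (l + 1) (f t) N)"
  shows "continuous_on UNIV (\<lambda>t. grid l (f t) m i)"
  using assms by (cases "i \<le> l") (simp_all add: grid_def)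

lemma continuous_family_opD: "continuous_family (l + 1) (\<lambda>\<alpha>. opD l \<alpha> \<beta> k)"
proof (rule continuous_familyI)
  fix f :: "real \<Rightarrow> complex poly vec" and N assume f: "\<And>t. f t \<in> carrier_vec (l + 1)"
    and c: "\<And>N. continuous_on UNIV (\<lambda>t. coord (l + 1) (f t) N)"
  have i: "N mod (l + 1) \<le> l" by (rule mod_le_dim)
  show "continuous_on UNIV (\<lambda>\<alpha>. coord (l + 1) (opD l \<alpha> \<beta> k (f \<alpha>)) N)"
    unfolding coord_grid grid_opD[OF f i] actD_def eigD_def
    by (intro continuous_intros continuous_grid c)
qed

lemma continuous_family_opE: "continuous_family (l + 1) (\<lambda>\<alpha>. opE l \<alpha> \<beta> k)"
proof (rule continuous_familyI)
  fix f :: "real \<Rightarrow> complex poly vec" and N assume f: "\<And>t. f t \<in> carrier_vec (l + 1)"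
    and c: "\<And>N. continuous_on UNIV (\<lambda>t. coord (l + 1) (f t) N)"
  have i: "N mod (l + 1) \<le> l" by (rule mod_le_dim)
  show "continuous_on UNIV (\<lambda>\<alpha>. coord (l + 1) (opE l \<alpha> \<beta> k (f \<alpha>)) N)"
    unfolding coord_grid grid_opE[OF f i] actE_def eigD_def slope_def shift_def
    by (intro continuous_intros continuous_grid c)
qed

text \<open>
  On one line the difference of the entries at degrees \<open>m\<close> and \<open>m'\<close> is, up to sign, the product of
  \<open>m - m'\<close> and \<open>m + m' + \<alpha> + \<beta> + l + j + 1\<close>, whose second factor is positive.
\<close>

lemma infinite_range_eigD_at:
  assumes "\<alpha> > -1" "\<beta> > -1" "l \<ge> 1" "j \<le> l"
  shows "infinite (range (\<lambda>m. eigD_at l \<alpha> \<beta> k (m * (l + 1) + j)))"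
proof -
  have "inj (\<lambda>m. eigD_at l \<alpha> \<beta> k (m * (l + 1) + j))"
  proof (rule injI, rule ccontr)
    fix m m' assume eq: "eigD_at l \<alpha> \<beta> k (m * (l + 1) + j) = eigD_at l \<alpha> \<beta> k (m' * (l + 1) + j)" and ne: "m \<noteq> m'"
    have "complex_of_real ((real m - real m') * (real m + real m' + (\<alpha> + \<beta> + real l + real j + 1))) = 0"
      using eq unfolding eigD_at_def index_div_mod[OF assms(4)] eigD_def by (simp add: algebra_simps)
    then have "real m + real m' + (\<alpha> + \<beta> + real l + real j + 1) = 0"
      using ne by (simp only: of_real_eq_0_iff mult_eq_0_iff) simp
    moreover have "real l \<ge> 1" using assms(3) by simp
    ultimately show False using assms by linarith
  qed
  then show ?thesis by (rule range_inj_infinite)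
qed

text \<open>
  The difference of the diagonal entries at \<open>(m, i)\<close> and \<open>(m', i')\<close> is affine in \<open>\<alpha>\<close> with slope
  \<open>(m' + i') - (m + i)\<close>, so two coincidences force \<open>m + i = m' + i'\<close>. Then the difference is
  \<open>(m - m') (i - l - k - m')\<close>, and its second factor is negative because \<open>i \<le> l\<close> and \<open>k > 0\<close>.
\<close>

lemma eigD_at_coincidence_unique:
  assumes "0 < k" "M \<noteq> N" "eigD_at l \<alpha> \<beta> k M = eigD_at l \<alpha> \<beta> k N" "eigD_at l \<alpha>' \<beta> k M = eigD_at l \<alpha>' \<beta> k N"
  shows "\<alpha> = \<alpha>'"
proof (rule ccontr)
  assume ne: "\<alpha> \<noteq> \<alpha>'"
  define m i m' i' where "m = M div (l + 1)" and "i = M mod (l + 1)"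
    and "m' = N div (l + 1)" and "i' = N mod (l + 1)"
  have il: "i \<le> l" "i' \<le> l"
    unfolding i_def i'_def by (rule mod_le_dim)+
  define \<delta> where "\<delta> a = real m * (1 - real m) - real m * (a + \<beta> + real l + real i + 2) - real i * (a + \<beta> - k + 1 + real i)
    - (real m' * (1 - real m') - real m' * (a + \<beta> + real l + real i' + 2) - real i' * (a + \<beta> - k + 1 + real i'))" for a
  have "complex_of_real (\<delta> a) = eigD_at l a \<beta> k M - eigD_at l a \<beta> k N" for a
    by (simp add: \<delta>_def eigD_at_def eigD_def m_def i_def m'_def i'_def)
  then have \<delta>: "\<delta> \<alpha> = 0" "\<delta> \<alpha>' = 0"
    using assms(3,4) by (metis of_real_eq_0_iff right_minus_eq)+
  have "(\<alpha>' - \<alpha>) * (real m + real i - (real m' + real i')) = \<delta> \<alpha> - \<delta> \<alpha>'"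
    by (simp add: \<delta>_def algebra_simps)
  then have s: "real i' = real m + real i - real m'"
    using ne \<delta> by simp
  have "(real m - real m') * (real i - real l - k - real m') = \<delta> \<alpha>"
    unfolding \<delta>_def s by (simp add: algebra_simps)
  also have "\<dots> = 0" by (rule \<delta>)
  finally have "real m = real m' \<or> real i - real l - k - real m' = 0"
    by (simp only: mult_eq_0_iff right_minus_eq)
  moreover have "real i - real l - k - real m' < 0"
    using il assms(1) by simp
  ultimately have "m = m'" by simp
  moreover from this have "i = i'" using s by simp
  ultimately have "M = N"
    unfolding m_def i_def m'_def i'_def by (metis div_mult_mod_eq)
  then show False using assms(2) by simp
qed

lemma countable_eigD_at_coincidence:
  assumes "0 < k"
  shows "countable {\<alpha>. \<not> inj (eigD_at l \<alpha> \<beta> k)}"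
proof -
  have "{\<alpha>. \<not> inj (eigD_at l \<alpha> \<beta> k)}
      \<subseteq> (\<Union>(M, N)\<in>{(M, N). M \<noteq> N}. {\<alpha>. eigD_at l \<alpha> \<beta> k M = eigD_at l \<alpha> \<beta> k N})"
    by (auto simp: inj_def)
  moreover have "countable {\<alpha>. eigD_at l \<alpha> \<beta> k M = eigD_at l \<alpha> \<beta> k N}" if "M \<noteq> N" for M N
  proof (cases "\<exists>a. eigD_at l a \<beta> k M = eigD_at l a \<beta> k N")
    case True
    then obtain a where "eigD_at l a \<beta> k M = eigD_at l a \<beta> k N" by blast
    then have "{\<alpha>. eigD_at l \<alpha> \<beta> k M = eigD_at l \<alpha> \<beta> k N} \<subseteq> {a}"
      using eigD_at_coincidence_unique[OF assms that] by blast
    then show ?thesis by (rule countable_subset) simp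
  qed simp
  ultimately show ?thesis
    by (elim countable_subset) (auto intro!: countable_UN)
qed

text \<open>
  For fixed \<open>f\<close> and \<open>N\<close>, the \<open>N\<close>-th coordinate of \<open>Q(D, E) f\<close> is a continuous function of \<open>\<alpha>\<close> that
  vanishes whenever the diagonal entries of \<open>D\<close> are distinct, that is, off a countable set. The set
  where it does not vanish is open and countable, hence empty.
\<close>

lemma polyQ_annihilates:
  assumes "0 < k"
  shows "commuting_operators.ev (l + 1) (opD l \<alpha> \<beta> k) (opE l \<alpha> \<beta> k) (polyQ l \<alpha> \<beta> k)
    = \<zero>\<^bsub>diff_op_ring (l + 1)\<^esub>"
proof -
  let ?n = "l + 1"
  define T where "T \<alpha> = commuting_operators.ev ?n (opD l \<alpha> \<beta> k) (opE l \<alpha> \<beta> k)" for \<alpha>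
  have generic: "T a (polyQ l a \<beta> k) = \<zero>\<^bsub>diff_op_ring ?n\<^esub>" if "inj (eigD_at l a \<beta> k)" for a
  proof -
    interpret commuting_operators ?n "opD l a \<beta> k" "opE l a \<beta> k"
      by (rule commuting_operators_opD_opE)
    show ?thesis
      unfolding T_def
      by (intro ev_eq_zeroI[OF triangular_opD triangular_opE that])
         (simp only: poly_poly_const poly_polyQ_branch[OF mod_le_dim] poly_0)
  qed
  have cont: "continuous_family ?n (\<lambda>a. T a (\<Prod>j\<in>J. [:- branch l a \<beta> k j, 1:]))" if "finite J" for J
    using that
  proof (induction J rule: finite_induct)
    case empty
    have "T a 1 = scalar_op ?n 1" for a
    proof -
      interpret commuting_operators ?n "opD l a \<beta> k" "opE l a \<beta> k"
        by (rule commuting_operators_opD_opE)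
      show ?thesis unfolding T_def ev_one by (rule inner.c_one[symmetric])
    qed
    then show ?case by (simp add: continuous_family_scalar_op)
  next
    case (insert j J)
    let ?P = "\<lambda>a. \<Prod>j\<in>J. [:- branch l a \<beta> k j, 1:]"
    let ?b = "\<lambda>a. shift (complex_of_real a) (of_real \<beta>) (of_real k) (of_nat l) j"
      and ?s = "\<lambda>a. slope (complex_of_real a) (of_nat l) j"
    have T: "T a ([:- branch l a \<beta> k j, 1:] * ?P a)
        = ((scalar_op ?n (?b a) \<oplus>\<^bsub>diff_op_ring ?n\<^esub> scalar_op ?n (- ?s a) \<otimes>\<^bsub>diff_op_ring ?n\<^esub> opD l a \<beta> k)
            \<oplus>\<^bsub>diff_op_ring ?n\<^esub> opE l a \<beta> k) \<otimes>\<^bsub>diff_op_ring ?n\<^esub> T a (?P a)"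
      and closed: "T a (?P a) \<in> carrier (diff_op_ring ?n)"
        "scalar_op ?n (- ?s a) \<otimes>\<^bsub>diff_op_ring ?n\<^esub> opD l a \<beta> k \<in> carrier (diff_op_ring ?n)"
        "scalar_op ?n (?b a) \<oplus>\<^bsub>diff_op_ring ?n\<^esub> scalar_op ?n (- ?s a) \<otimes>\<^bsub>diff_op_ring ?n\<^esub> opD l a \<beta> k
          \<in> carrier (diff_op_ring ?n)" for a
    proof -
      interpret commuting_operators ?n "opD l a \<beta> k" "opE l a \<beta> k"
        by (rule commuting_operators_opD_opE)
      have "[:- branch l a \<beta> k j, 1:] = const_xy (?b a) + const_xy (- ?s a) * var_x + var_y"
        by (simp add: branch_def const_xy_def var_x_def var_y_def)
      then show "T a ([:- branch l a \<beta> k j, 1:] * ?P a)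
        = ((scalar_op ?n (?b a) \<oplus>\<^bsub>diff_op_ring ?n\<^esub> scalar_op ?n (- ?s a) \<otimes>\<^bsub>diff_op_ring ?n\<^esub> opD l a \<beta> k)
            \<oplus>\<^bsub>diff_op_ring ?n\<^esub> opE l a \<beta> k) \<otimes>\<^bsub>diff_op_ring ?n\<^esub> T a (?P a)"
        unfolding T_def by (simp only: outer.subst_mult outer.subst_add ev_const ev_x ev_y)
      show "T a (?P a) \<in> carrier (diff_op_ring ?n)"
        unfolding T_def by (rule outer.subst_closed)
      show "scalar_op ?n (- ?s a) \<otimes>\<^bsub>diff_op_ring ?n\<^esub> opD l a \<beta> k \<in> carrier (diff_op_ring ?n)"
        by (intro inner.m_closed scalar_op_carrier opD_carrier)
      then show "scalar_op ?n (?b a) \<oplus>\<^bsub>diff_op_ring ?n\<^esub> scalar_op ?n (- ?s a) \<otimes>\<^bsub>diff_op_ring ?n\<^esub> opD l a \<beta> k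
          \<in> carrier (diff_op_ring ?n)"
        by (intro inner.a_closed scalar_op_carrier)
    qed
    have "continuous_family ?n (\<lambda>a. T a ([:- branch l a \<beta> k j, 1:] * ?P a))"
      unfolding T
      by (intro continuous_family_mult continuous_family_add continuous_family_scalar_op
          continuous_family_opD continuous_family_opE insert.IH closed opD_carrier opE_carrier
          scalar_op_carrier zero_less_Suc[folded Suc_eq_plus1])
         (auto simp: shift_def slope_def intro!: continuous_intros)
    then show ?case by (simp only: prod.insert[OF insert.hyps])
  qed
  have Q_closed: "T a (polyQ l a \<beta> k) \<in> carrier (diff_op_ring ?n)" for a
  proof -
    interpret commuting_operators ?n "opD l a \<beta> k" "opE l a \<beta> k"
      by (rule commuting_operators_opD_opE)
    show ?thesis unfolding T_def by (rule outer.subst_closed)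
  qed
  have "T \<alpha> (polyQ l \<alpha> \<beta> k) f = 0\<^sub>v ?n" if f: "f \<in> carrier_vec ?n" for f
  proof (rule coord_eqI[OF diff_op_mem_closed[OF Q_closed f]])
    fix N
    define g where "g a = coord ?n (T a (polyQ l a \<beta> k) f) N" for a
    \<comment> \<open>\<open>Q\<close> itself varies with \<open>\<alpha>\<close>, which is why the family is followed through the product of its factors.\<close>
    have "continuous_on UNIV g"
      unfolding g_def polyQ_eq by (rule continuous_familyD[OF cont]) (simp, rule f, rule continuous_on_const)
    then have "open {a. g a \<noteq> 0}"
      by (intro open_Collect_neq continuous_intros)
    moreover have "g a = 0" if "inj (eigD_at l a \<beta> k)" for a
      using generic[OF that] f by (simp add: g_def diff_op_ring_zero coord_zero)
    ultimately have "{a. g a \<noteq> 0} = {}"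
      using open_minus_countable[OF countable_eigD_at_coincidence[OF assms], of "{a. g a \<noteq> 0}" l \<beta>] by blast
    then show "coord ?n (T \<alpha> (polyQ l \<alpha> \<beta> k) f) N = coord ?n (0\<^sub>v ?n) N"
      by (simp add: g_def coord_zero)
  qed simp
  then have "(\<lambda>f\<in>carrier_vec ?n. T \<alpha> (polyQ l \<alpha> \<beta> k) f) = (\<lambda>f\<in>carrier_vec ?n. 0\<^sub>v ?n)"
    by (intro restrict_ext) simp
  then show ?thesis
    by (simp only: diff_op_mem_ext[OF Q_closed] diff_op_ring_zero T_def[symmetric])
qed

text \<open>
  On the \<open>j\<close>-th line \<open>p\<close> restricts to a polynomial in \<open>x\<close> with infinitely many zeros. So \<open>p\<close>, as a
  polynomial in \<open>y\<close>, has the \<open>l + 1\<close> lines as roots, which are distinct because their slopes are.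
\<close>

lemma polyQ_dvdI:
  assumes "\<alpha> > -1" "\<beta> > -1" "l \<ge> 1"
    and zero: "\<And>N. poly (poly p [:poly (branch l \<alpha> \<beta> k (N mod (l + 1))) (eigD_at l \<alpha> \<beta> k N):]) (eigD_at l \<alpha> \<beta> k N) = 0"
  shows "polyQ l \<alpha> \<beta> k dvd p"
  unfolding polyQ_eq
proof (rule prod_linear_dvd)
  show "inj_on (branch l \<alpha> \<beta> k) {0..l}"
    using inj_branch by (rule inj_on_subset) simp
  fix j assume "j \<in> {0..l}"
  then have j: "j \<le> l" by simp
  have "poly (poly p (branch l \<alpha> \<beta> k j)) (eigD_at l \<alpha> \<beta> k (m * (l + 1) + j)) = 0" for m
    using zero[of "m * (l + 1) + j"] by (simp only: index_div_mod[OF j] poly_poly_const)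
  then have "infinite {z. poly (poly p (branch l \<alpha> \<beta> k j)) z = 0}"
    using infinite_range_eigD_at[OF assms(1-3) j, of k] by (elim infinite_super[rotated]) auto
  then show "poly p (branch l \<alpha> \<beta> k j) = 0"
    using poly_roots_finite by blast
qed simp

theorem theorem5p3:
  fixes \<alpha> \<beta> k :: real and l :: nat
  assumes "\<alpha> > -1" and "\<beta> > -1" and "0 < k" and "k < \<beta> + 1" and "l \<ge> 1"
  shows "complex_alg_isomorphic
           (generated_algebra (l + 1) {opD l \<alpha> \<beta> k, opE l \<alpha> \<beta> k}) (scalar_op (l + 1))
           (quotient_xy (polyQ l \<alpha> \<beta> k)) (quotient_xy_scalar (polyQ l \<alpha> \<beta> k))"
proof -
  interpret commuting_operators "l + 1" "opD l \<alpha> \<beta> k" "opE l \<alpha> \<beta> k"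
    by (rule commuting_operators_opD_opE)
  show ?thesis
  proof (rule isomorphic_quotient, rule iffI)
    fix p assume "ev p = \<zero>\<^bsub>diff_op_ring (l + 1)\<^esub>"
    then show "polyQ l \<alpha> \<beta> k dvd p"
      by (intro polyQ_dvdI[OF assms(1,2,5)] ev_eq_zeroD[OF triangular_opD triangular_opE])
  next
    fix p assume "polyQ l \<alpha> \<beta> k dvd p"
    then obtain s where "p = polyQ l \<alpha> \<beta> k * s" by (elim dvdE)
    then show "ev p = \<zero>\<^bsub>diff_op_ring (l + 1)\<^esub>"
      by (simp only: outer.subst_mult polyQ_annihilates[OF assms(3)] inner.l_null outer.subst_closed)
  qed
qed

end
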